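(* Let $1\le p\le 2\le q<\infty$, and let $U=\bigoplus_{n=1}^\infty U_n\colon\ell_p\to\ell_q$ be the block Hadamard operator, where $U_n=N^{-1/\min\{p',q\}}H_n\colon\ell_p^{N}\to\ell_q^{N}$ with $N=2^n$ and $H_n$ is the $2^n\times 2^n$ Hadamard matrix. Then $U$ has the following properties: (1) $\|U\|_{p,q}=1$ (the norm of $U$ as an operator from $\ell_p$ to $\ell_q$). (2) $U$ is not compact. (3) If $p'\ne q$ then $U$ is finitely strictly singular. (4) Let $p\le r\le q$. Then $U$ factors through $\ell_r$ when $p\le r\le q'$ or $p'\le r\le q$; otherwise $U\notin\mathcal J^{\ell_r}$. (5) In particular, if $p\ne q$ then $U\notin\mathcal J^{\ell_2}$.
   Context: For an exponent $s$, $s'$ denotes its conjugate exponent, $\frac1s+\frac1{s'}=1$ (with $1'=\infty$). The Hadamard matrices are defined by $H_0=(1)$ and $H_{n+1}=\begin{pmatrix}H_n&H_n\\H_n&-H_n\end{pmatrix}$, so $H_n$ is $2^n\times2^n$. One identifies $\ell_p=\bigl(\bigoplus_{n=1}^\infty\ell_p^{2^n}\bigr)_p$ and $\ell_q=\bigl(\bigoplus_{n=1}^\infty\ell_q^{2^n}\bigr)_q$ via consecutive blocks of the standard bases, and $U$ acts as $U_n$ from the $n$-th block to the $n$-th block. $L(\ell_p,\ell_q)$ is the space of bounded linear operators from $\ell_p$ to $\ell_q$. An operator $S\in L(\ell_p,\ell_q)$ factors through a Banach space $Z$ if $S=AB$ with bounded linear $B\colon\ell_p\to Z$ and $A\colon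 Z\to\ell_q$; $\mathcal J^{Z}$ is the operator-norm closure in $L(\ell_p,\ell_q)$ of the set of such operators. A bounded operator $S\colon X\to Y$ between Banach spaces is finitely strictly singular (FSS) if for every $\varepsilon>0$ there is $n\in\mathbb N$ such that $\inf_{x\in E,\|x\|=1}\|Sx\|<\varepsilon$ for every $n$-dimensional subspace $E$ of $X$.
   Formalization: In (4), U∉J^{ℓ_r} is claimed only for r≠p and r≠q, and (5) assumes p≠2 and q≠2 instead of p≠q, since every operator from ℓ_p to ℓ_q factors trivially through ℓ_p and ℓ_q (e.g. p=1, q=r=4; or p=1, q=2). *)

theory Defs
  imports "HOL-Analysis.Analysis" "HOL-Library.Function_Algebras"
begin

text \<open>
  The scalar field is a type \<open>'a\<close> of sort \<open>{real_normed_field, euclidean_space}\<close>, so that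
  everything below covers both the real and the complex spaces $\ell_p$. Sequences are indexed
  from 0, and addition and subtraction of sequences are pointwise.
\<close>

subsection \<open>The spaces $\ell_p$\<close>

definition lp :: "real \<Rightarrow> (nat \<Rightarrow> 'a::real_normed_vector) set" where
  "lp p = {x. summable (\<lambda>k. norm (x k) powr p)}"

definition lp_norm :: "real \<Rightarrow> (nat \<Rightarrow> 'a::real_normed_vector) \<Rightarrow> real" where
  "lp_norm p x = (\<Sum>k. norm (x k) powr p) powr (1 / p)"

definition seq_scale :: "'a::field \<Rightarrow> (nat \<Rightarrow> 'a) \<Rightarrow> nat \<Rightarrow> 'a" where
  "seq_scale c x = (\<lambda>k. c * x k)"

lemma vector_space_seq_scale: "vector_space seq_scale"
  by unfold_locales (auto simp: seq_scale_def fun_eq_iff algebra_simps)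

definition lp_topology :: "real \<Rightarrow> (nat \<Rightarrow> 'a::real_normed_vector) topology" where
  "lp_topology p = Metric_space.mtopology (lp p) (\<lambda>x y. lp_norm p (x - y))"

text \<open>
  The conjugate exponent of $s \in [1,\infty)$, with values in $[1,\infty]$.
\<close>

definition conj_exp :: "real \<Rightarrow> ereal" where
  "conj_exp s = (if s = 1 then \<infinity> else ereal (s / (s - 1)))"

lemma conj_exp_conjugate:
  assumes "1 \<le> s"
  shows "1 / ereal s + 1 / conj_exp s = 1"
proof (cases "s = 1")
  case True
  then show ?thesis by (simp add: conj_exp_def one_ereal_def)
next
  case False
  then have "1 / s + 1 / (s / (s - 1)) = 1" using assms by (simp add: field_simps)
  then show ?thesis using False assms by (simp add: conj_exp_def one_ereal_def)
qed


subsection \<open>Operators from $\ell_p$ to $\ell_q$\<close>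

text \<open>
  An operator is represented by a function on all sequences; only its values on \<^term>\<open>lp p\<close>
  matter.
\<close>

definition bounded_op ::
    "real \<Rightarrow> real \<Rightarrow> ((nat \<Rightarrow> 'a::real_normed_field) \<Rightarrow> nat \<Rightarrow> 'a) \<Rightarrow> bool" where
  "bounded_op p q T \<longleftrightarrow>
     (\<forall>x\<in>lp p. T x \<in> lp q) \<and>
     (\<forall>x\<in>lp p. \<forall>y\<in>lp p. T (x + y) = T x + T y) \<and>
     (\<forall>c. \<forall>x\<in>lp p. T (seq_scale c x) = seq_scale c (T x)) \<and>
     (\<exists>C. \<forall>x\<in>lp p. lp_norm q (T x) \<le> C * lp_norm p x)"

definition op_norm ::
    "real \<Rightarrow> real \<Rightarrow> ((nat \<Rightarrow> 'a::real_normed_field) \<Rightarrow> nat \<Rightarrow> 'a) \<Rightarrow> real" where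
  "op_norm p q T = (SUP x\<in>{x\<in>lp p. lp_norm p x \<le> 1}. lp_norm q (T x))"

definition compact_op ::
    "real \<Rightarrow> real \<Rightarrow> ((nat \<Rightarrow> 'a::real_normed_field) \<Rightarrow> nat \<Rightarrow> 'a) \<Rightarrow> bool" where
  "compact_op p q T \<longleftrightarrow> bounded_op p q T \<and>
     compactin (lp_topology q) (lp_topology q closure_of (T ` {x\<in>lp p. lp_norm p x \<le> 1}))"

text \<open>
  Subspaces and dimensions are over the scalar field \<open>'a\<close>. The dimension \<open>n\<close> is positive, since
  the infimum over the empty unit sphere of the zero subspace is $+\infty$; as
  \<^const>\<open>vector_space.dim\<close> is 0 in the infinite-dimensional case, this also makes \<open>E\<close>
  finite-dimensional.
\<close>

definition finitely_strictly_singular ::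
    "real \<Rightarrow> real \<Rightarrow> ((nat \<Rightarrow> 'a::real_normed_field) \<Rightarrow> nat \<Rightarrow> 'a) \<Rightarrow> bool" where
  "finitely_strictly_singular p q T \<longleftrightarrow> bounded_op p q T \<and>
     (\<forall>\<epsilon>>0. \<exists>n\<ge>1. \<forall>E. E \<subseteq> lp p \<and> module.subspace seq_scale E \<and> vector_space.dim seq_scale E = n
        \<longrightarrow> (INF x\<in>{x\<in>E. lp_norm p x = 1}. lp_norm q (T x)) < \<epsilon>)"

definition factors_through ::
    "real \<Rightarrow> real \<Rightarrow> real \<Rightarrow> ((nat \<Rightarrow> 'a::real_normed_field) \<Rightarrow> nat \<Rightarrow> 'a) \<Rightarrow> bool" where
  "factors_through r p q S \<longleftrightarrow>
     bounded_op p q S \<and>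
     (\<exists>A B. bounded_op p r B \<and> bounded_op r q A \<and> (\<forall>x\<in>lp p. S x = A (B x)))"

text \<open>$\mathcal J^{\ell_r}$ as a subset of $L(\ell_p,\ell_q)$.\<close>

definition factor_closure ::
    "real \<Rightarrow> real \<Rightarrow> real \<Rightarrow> ((nat \<Rightarrow> 'a::real_normed_field) \<Rightarrow> nat \<Rightarrow> 'a) set" where
  "factor_closure r p q =
     {T. bounded_op p q T \<and>
         (\<forall>\<epsilon>>0. \<exists>S. factors_through r p q S \<and> op_norm p q (\<lambda>x. T x - S x) < \<epsilon>)}"


subsection \<open>The block Hadamard operator\<close>

text \<open>Row and column indices of the \<open>n\<close>-th Hadamard matrix range over \<open>{..<2 ^ n}\<close>.\<close>

primrec hadamard :: "nat \<Rightarrow> nat \<Rightarrow> nat \<Rightarrow> real" where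
  "hadamard 0 i j = 1"
| "hadamard (Suc n) i j =
     (if i < 2 ^ n
      then (if j < 2 ^ n then hadamard n i j else hadamard n i (j - 2 ^ n))
      else (if j < 2 ^ n then hadamard n (i - 2 ^ n) j else - hadamard n (i - 2 ^ n) (j - 2 ^ n)))"

definition hadamard_block ::
    "real \<Rightarrow> real \<Rightarrow> nat \<Rightarrow> (nat \<Rightarrow> 'a::real_vector) \<Rightarrow> nat \<Rightarrow> 'a" where
  "hadamard_block p q n v i =
     real (2 ^ n) powr (- 1 / real_of_ereal (min (conj_exp p) (ereal q))) *\<^sub>R
       (\<Sum>j<2 ^ n. hadamard n i j *\<^sub>R v j)"

text \<open>
  The \<open>n\<close>-th block (\<open>n \<ge> 1\<close>) consists of the \<open>2 ^ n\<close> consecutive indices from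
  \<open>block_start n\<close> up to, but excluding, \<open>block_start (Suc n)\<close>.
\<close>

definition block_start :: "nat \<Rightarrow> nat" where
  "block_start n = (\<Sum>m = 1..<n. 2 ^ m)"

definition block_of :: "nat \<Rightarrow> nat" where
  "block_of k = (LEAST n. k < block_start (Suc n))"

definition hadamard_op ::
    "real \<Rightarrow> real \<Rightarrow> (nat \<Rightarrow> 'a::real_vector) \<Rightarrow> nat \<Rightarrow> 'a" where
  "hadamard_op p q x k =
     (let n = block_of k
      in hadamard_block p q n (\<lambda>j. x (block_start n + j)) (k - block_start n))"

lemma block_of_block_start:
  assumes "1 \<le> n" "i < 2 ^ n"
  shows "block_of (block_start n + i) = n"
  unfolding block_of_def
proof (rule Least_equality)
  show "block_start n + i < block_start (Suc n)"
    using assms by (simp add: block_start_def)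
next
  fix m assume m: "block_start n + i < block_start (Suc m)"
  show "n \<le> m"
  proof (rule ccontr)
    assume "\<not> n \<le> m"
    then have "block_start (Suc m) \<le> block_start n"
      unfolding block_start_def by (intro sum_mono2) auto
    with m show False by simp
  qed
qed

lemma hadamard_op_block:
  assumes "1 \<le> n" "i < 2 ^ n"
  shows "hadamard_op p q x (block_start n + i) =
           hadamard_block p q n (\<lambda>j. x (block_start n + j)) i"
  using assms by (simp add: hadamard_op_def block_of_block_start)

end

theory Submission
  imports Defs
begin

text \<open>
  Write \<open>s'\<close> for the conjugate exponent of \<open>s\<close>, and let \<open>s = min p' q\<close>, so that the block of length
  \<open>N\<close> of the operator is \<open>N powr (- 1 / s)\<close> times a Hadamard matrix. Then \<open>s \<ge> 2\<close>, \<open>p \<le> s'\<close> and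
  \<open>s \<le> q\<close>, and one of the last two inequalities is an equality.

  \<^bold>\<open>Norm.\<close> The Hadamard matrix has norm \<open>N powr (1 / s)\<close> from the \<open>s'\<close>-norm to the \<open>s\<close>-norm
  (\<open>Hausdorff_Young_hadamard\<close>). For order 2 this is Clarkson's inequality
  (\<open>two_point_inequality\<close>), and the general case follows because the matrices are tensor powers and
  \<open>s' \<le> s\<close>. As \<open>s' \<le> s\<close> also lets the blocks be summed, the block operator is a contraction from
  the \<open>s'\<close>-summable to the \<open>s\<close>-summable sequences, hence from \<open>a\<close>-summable to \<open>b\<close>-summable ones
  whenever \<open>a \<le> s'\<close> and \<open>s \<le> b\<close>. Since \<open>s = q\<close> or \<open>s' = p\<close>, every block contains a normalised
  vector with image of norm at least 1 (\<open>block_norming_vector\<close>). So the norm is 1, and the images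
  of these vectors are separated, so the operator is not compact.

  \<^bold>\<open>Finite strict singularity.\<close> The operator acts from \<open>p\<close>- to \<open>s'\<close>- to \<open>s\<close>- to \<open>q\<close>-summable
  sequences, where the first and the last step are inclusions. If \<open>p' \<noteq> q\<close>, one of the two changes
  the exponent. An \<open>n\<close>-dimensional space of null sequences contains a vector attaining its sup norm
  at \<open>n\<close> coordinates (\<open>exists_flat_image\<close>), and on such vectors an inclusion with distinct exponents
  is small, uniformly in the space (\<open>flat_lp_norm_le\<close>).

  \<^bold>\<open>Factorization.\<close> If \<open>r \<le> q'\<close> or \<open>p' \<le> r\<close>, then \<open>r \<le> s'\<close> or \<open>s \<le> r\<close>, and the operator factors
  through the inclusion of the \<open>p\<close>-summable into the \<open>r\<close>-summable sequences, or of the latter into the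
  \<open>q\<close>-summable ones. For the remaining \<open>r\<close> other than \<open>p\<close> and \<open>q\<close> one has \<open>s' < r < s\<close>. Then
  compare traces against the Hadamard matrix \<open>H\<close> of a block of length \<open>N\<close>. The trace of \<open>H\<close> times
  the block of the operator is \<open>N powr (2 - 1 / s)\<close>, and an operator within \<open>1 / 2\<close> of it has at
  least half of that trace. For a product \<open>A B\<close> through the \<open>r\<close>-summable sequences the trace is of
  smaller order: \<open>H\<close> acts on the columns of \<open>B\<close> (if \<open>p = s'\<close>, \<open>factored_row_coordinate_small\<close>) or on
  the rows of \<open>A\<close> (if \<open>q = s\<close>, \<open>factored_pairing_small\<close>), which are bounded sequences in the \<open>r\<close>-norm
  or the \<open>r'\<close>-norm, and the Hausdorff-Young inequality bounds their transforms in the mean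
  (\<open>hadamard_transform_rows_bound\<close>).
\<close>

section \<open>Inequalities for powers\<close>

lemma powr_le_powr_imp_le:
  fixes x y a :: real
  assumes "x powr a \<le> y powr a" "0 < a" "0 \<le> y"
  shows "x \<le> y"
  using assms powr_less_mono2[of a y x] by linarith

lemma powr_convex_combination:
  fixes s x y u :: real
  assumes "1 \<le> s" "0 \<le> x" "0 \<le> y" "0 \<le> u" "u \<le> 1"
  shows "(u * x + (1 - u) * y) powr s \<le> u * x powr s + (1 - u) * y powr s"
proof -
  have edge: "(v * z) powr s \<le> v * z powr s" if "0 \<le> v" "v \<le> 1" "0 \<le> z" for v z :: real
  proof -
    have "v powr s \<le> v"
      using powr_mono'[of 1 s v] that assms(1) by (cases "v = 0") auto
    then show ?thesis using that by (simp add: powr_mult mult_right_mono)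
  qed
  show ?thesis
  proof (cases "x = 0 \<or> y = 0")
    case True
    then show ?thesis using edge[of u x] edge[of "1 - u" y] assms by auto
  next
    case False
    then have "x > 0" "y > 0" using assms by auto
    then show ?thesis
      using convex_onD[OF powr_convex[OF assms(1)], of "1 - u" x y] assms by simp
  qed
qed

lemma Holder_inequality_sum:
  fixes f g :: "'i \<Rightarrow> real"
  assumes "1 < s" "1 / s + 1 / t = 1" "finite I"
    and nn: "\<And>i. i \<in> I \<Longrightarrow> 0 \<le> f i" "\<And>i. i \<in> I \<Longrightarrow> 0 \<le> g i"
  shows "(\<Sum>i\<in>I. f i * g i) \<le> (\<Sum>i\<in>I. f i powr s) powr (1 / s) * (\<Sum>i\<in>I. g i powr t) powr (1 / t)"
proof -
  have t: "1 < t"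
  proof -
    have "1 / t = 1 - 1 / s" "0 < 1 - 1 / s" "1 - 1 / s < 1" using assms by auto
    then have "0 < 1 / t" "1 / t < 1" by simp_all
    then show ?thesis by (simp add: divide_less_eq split: if_splits)
  qed
  define F where "F = (\<Sum>i\<in>I. f i powr s)"
  define G where "G = (\<Sum>i\<in>I. g i powr t)"
  have F0: "0 \<le> F" and G0: "0 \<le> G" unfolding F_def G_def by (auto intro: sum_nonneg)
  show ?thesis
  proof (cases "F = 0 \<or> G = 0")
    case True
    have "f i * g i = 0" if "i \<in> I" for i
    proof -
      from True have "f i powr s = 0 \<or> g i powr t = 0"
        using that assms(3) unfolding F_def G_def by (auto simp: sum_nonneg_eq_0_iff)
      then show ?thesis by auto
    qed
    then have "(\<Sum>i\<in>I. f i * g i) = 0" by (intro sum.neutral) blast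
    then show ?thesis by (metis mult_nonneg_nonneg powr_ge_zero)
  next
    case False
    then have pos: "F > 0" "G > 0" using F0 G0 by auto
    \<comment> \<open>Young's inequality for both factors normalised to norm one.\<close>
    have Y: "f i * g i \<le> F powr (1/s) * G powr (1/t) * (f i powr s / F / s + g i powr t / G / t)"
      if "i \<in> I" for i
    proof -
      have "f i / F powr (1/s) * (g i / G powr (1/t)) \<le>
          (f i / F powr (1/s)) powr s / s + (g i / G powr (1/t)) powr t / t"
        by (rule Youngs_inequality) (use assms t nn that in auto)
      also have "\<dots> = f i powr s / F / s + g i powr t / G / t"
        using pos assms t nn[OF that] by (simp add: powr_divide powr_powr)
      finally show ?thesis using pos by (simp add: field_simps)
    qed
    have "(\<Sum>i\<in>I. f i * g i) \<le>
        (\<Sum>i\<in>I. F powr (1/s) * G powr (1/t) * (f i powr s / F / s + g i powr t / G / t))"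
      by (intro sum_mono Y)
    also have "\<dots> = F powr (1/s) * G powr (1/t) * (F / F / s + G / G / t)"
      unfolding F_def G_def sum_distrib_left[symmetric] sum.distrib sum_divide_distrib[symmetric] ..
    also have "\<dots> = F powr (1/s) * G powr (1/t)" using pos assms(2) by simp
    finally show ?thesis unfolding F_def G_def .
  qed
qed

lemma power_mean_inequality:
  fixes f :: "'i \<Rightarrow> real"
  assumes "1 \<le> s" "finite I" "\<And>i. i \<in> I \<Longrightarrow> 0 \<le> f i"
  shows "(\<Sum>i\<in>I. f i) powr s \<le> real (card I) powr (s - 1) * (\<Sum>i\<in>I. f i powr s)"
proof (cases "s = 1")
  case True
  have "(\<Sum>i\<in>I. f i) \<ge> 0" using assms by (intro sum_nonneg) auto
  with True assms show ?thesis
    by (cases "I = {}") auto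
next
  case False
  with assms have s: "1 < s" by simp
  have "(\<Sum>i\<in>I. f i * 1) \<le> (\<Sum>i\<in>I. f i powr s) powr (1 / s) *
      (\<Sum>i\<in>I. 1 powr (s / (s - 1))) powr (1 / (s / (s - 1)))"
    by (rule Holder_inequality_sum) (use s assms in \<open>auto simp: field_simps\<close>)
  then have "(\<Sum>i\<in>I. f i) powr s \<le>
      ((\<Sum>i\<in>I. f i powr s) powr (1 / s) * real (card I) powr ((s - 1) / s)) powr s"
    using s assms by (intro powr_mono2) (auto intro: sum_nonneg)
  also have "\<dots> = real (card I) powr (s - 1) * (\<Sum>i\<in>I. f i powr s)"
    using s by (simp add: powr_mult powr_powr sum_nonneg)
  finally show ?thesis .
qed

lemma Minkowski_inequality_sum:
  fixes f g :: "'i \<Rightarrow> real"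
  assumes "1 \<le> s" "finite I" "0 \<le> a" "0 \<le> b"
    and nn: "\<And>i. i \<in> I \<Longrightarrow> 0 \<le> f i" "\<And>i. i \<in> I \<Longrightarrow> 0 \<le> g i"
    and f: "(\<Sum>i\<in>I. f i powr s) \<le> a powr s" and g: "(\<Sum>i\<in>I. g i powr s) \<le> b powr s"
  shows "(\<Sum>i\<in>I. (f i + g i) powr s) \<le> (a + b) powr s"
proof -
  have zero: "h i = 0" if "(\<Sum>i\<in>I. h i powr s) \<le> 0 powr s" "i \<in> I" for h i
  proof -
    have "(\<Sum>i\<in>I. h i powr s) = 0" using that by (simp add: antisym sum_nonneg)
    then show ?thesis using that assms(2) by (auto simp: sum_nonneg_eq_0_iff)
  qed
  show ?thesis
  proof (cases "a = 0 \<or> b = 0")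
    case True
    then show ?thesis
    proof
      assume "a = 0"
      then show ?thesis using zero[of f] f g by (simp cong: sum.cong)
    next
      assume "b = 0"
      then show ?thesis using zero[of g] f g by (simp cong: sum.cong)
    qed
  next
    case False
    then have pos: "a > 0" "b > 0" using assms by auto
    define u where "u = a / (a + b)"
    have u: "0 \<le> u" "u \<le> 1" "1 - u = b / (a + b)" using pos by (auto simp: u_def field_simps)
    \<comment> \<open>Both functions are normalised, so that their sum becomes a convex combination.\<close>
    have C: "(f i + g i) powr s \<le>
        (a + b) powr s * (u * (f i powr s / a powr s) + (1 - u) * (g i powr s / b powr s))"
      if "i \<in> I" for i
    proof -
      have "f i + g i = (a + b) * (u * (f i / a) + (1 - u) * (g i / b))"
        unfolding u(3) using pos by (simp add: u_def distrib_left)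
      then have "(f i + g i) powr s = (a + b) powr s * (u * (f i / a) + (1 - u) * (g i / b)) powr s"
        using pos u nn[OF that] by (simp add: powr_mult)
      also have "\<dots> \<le> (a + b) powr s * (u * (f i / a) powr s + (1 - u) * (g i / b) powr s)"
        by (intro mult_left_mono powr_convex_combination) (use u pos nn[OF that] assms in auto)
      finally show ?thesis using pos nn[OF that] by (simp add: powr_divide)
    qed
    have "(\<Sum>i\<in>I. (f i + g i) powr s) \<le>
       (\<Sum>i\<in>I. (a + b) powr s * (u * (f i powr s / a powr s) + (1 - u) * (g i powr s / b powr s)))"
      by (intro sum_mono C)
    also have "\<dots> = (a + b) powr s *
        (u * ((\<Sum>i\<in>I. f i powr s) / a powr s) + (1 - u) * ((\<Sum>i\<in>I. g i powr s) / b powr s))"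
      by (simp add: sum.distrib sum_divide_distrib sum_distrib_left distrib_left)
    also have "\<dots> \<le> (a + b) powr s * (u * 1 + (1 - u) * 1)"
      by (intro mult_left_mono add_mono) (use u pos f g in \<open>auto simp: divide_le_eq_1\<close>)
    finally show ?thesis by simp
  qed
qed

lemma sum_powr_le_powr_sum:
  fixes f :: "'i \<Rightarrow> real"
  assumes "1 \<le> t" "finite I" "\<And>i. i \<in> I \<Longrightarrow> 0 \<le> f i"
  shows "(\<Sum>i\<in>I. f i powr t) \<le> (\<Sum>i\<in>I. f i) powr t"
proof -
  define M where "M = (\<Sum>i\<in>I. f i)"
  have M: "0 \<le> M" "f i \<le> M" if "i \<in> I" for i
    using assms that unfolding M_def by (auto intro: member_le_sum sum_nonneg)
  have pw: "x powr t = x powr (t - 1) * x" if "0 \<le> x" for x :: real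
    using that powr_add[of x "t - 1" 1] by (cases "x = 0") auto
  have "(\<Sum>i\<in>I. f i powr t) \<le> (\<Sum>i\<in>I. M powr (t - 1) * f i)"
  proof (rule sum_mono)
    fix i assume i: "i \<in> I"
    have "f i powr (t - 1) * f i \<le> M powr (t - 1) * f i"
      using M[OF i] assms i by (intro mult_right_mono powr_mono2) auto
    then show "f i powr t \<le> M powr (t - 1) * f i" using pw assms i by simp
  qed
  also have "\<dots> = M powr (t - 1) * M" by (simp add: M_def sum_distrib_left)
  also have "\<dots> = M powr t" using pw assms by (simp add: M_def sum_nonneg)
  finally show ?thesis unfolding M_def .
qed

section \<open>The two-point inequality\<close>

lemma gbinomial_Suc_ratio:
  fixes a :: real
  shows "a gchoose Suc k = (a - real k) / real (Suc k) * (a gchoose k)"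
  using gbinomial_mult_1[of a k] by (simp add: field_simps)

lemma gbinomial_odd_nonneg:
  fixes a :: real
  assumes "0 < a" "a \<le> 1"
  shows "0 \<le> a gchoose (2 * m + 1)"
proof (induction m)
  case 0
  then show ?case using assms by simp
next
  case (Suc m)
  have "a gchoose (2 * Suc m + 1) =
      ((a - real (2 * m + 2)) / real (2 * m + 3) * ((a - real (2 * m + 1)) / real (2 * m + 2))) *
        (a gchoose (2 * m + 1))"
    using gbinomial_Suc_ratio[of a "2 * m + 2"] gbinomial_Suc_ratio[of a "2 * m + 1"]
    by (simp add: numeral_3_eq_3 mult_ac)
  moreover have "0 \<le> (a - real (2 * m + 2)) / real (2 * m + 3) * ((a - real (2 * m + 1)) / real (2 * m + 2))"
    using assms by (intro mult_nonpos_nonpos divide_nonpos_pos) auto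
  ultimately show ?case using Suc by (metis mult_nonneg_nonneg)
qed

text \<open>
  Both sides are binomial series in \<open>z\<close>. The even term \<open>2 k\<close> on the right dominates the terms
  \<open>2 k - 1\<close> and \<open>2 k\<close> on the left: after division by the common factor
  \<open>(p - 1) gchoose (2 k - 1) \<ge> 0\<close> this is the weighted inequality of arithmetic and geometric means,
  with weights \<open>p / (2 k)\<close> and \<open>1 - p / (2 k)\<close>.
\<close>

lemma binomial_powr_comparison:
  fixes p s z :: real
  assumes p: "1 < p" "p \<le> 2" and s: "s = p / (p - 1)" and z: "0 \<le> z" "z \<le> 1"
  shows "(1 + z powr s) powr (p - 1) \<le> ((1 + z) powr p + (1 - z) powr p) / 2"
proof -
  consider "z = 0" | "z = 1" | "0 < z" "z < 1" using z by linarith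
  then show ?thesis
  proof cases
    case 1
    then show ?thesis by simp
  next
    case 2
    then show ?thesis using powr_add[of 2 "p - 1" 1] by simp
  next
    case 3
    define w where "w = z powr s"
    have "s > 0" using p s by simp
    then have w: "0 < w" "w < 1" unfolding w_def using 3 powr_less_mono2[of s z 1] by auto
    define f where "f n = ((p - 1) gchoose n) * w ^ n" for n
    define g where "g n = (p gchoose n) * ((z ^ n + (- z) ^ n) / 2)" for n
    have f: "f sums (1 + w) powr (p - 1)"
      unfolding f_def using gen_binomial_real[of w "p - 1"] w by simp
    have "(\<lambda>n. ((p gchoose n) * z ^ n + (p gchoose n) * (- z) ^ n) / 2) sums
        (((1 + z) powr p + (1 - z) powr p) / 2)"
      using gen_binomial_real[of z p] gen_binomial_real[of "- z" p] 3
      by (intro sums_divide sums_add) auto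
    then have g: "g sums (((1 + z) powr p + (1 - z) powr p) / 2)"
      unfolding g_def by (simp add: algebra_simps)
    have pair: "(\<lambda>m. h (2 * m + 1) + h (2 * m + 2)) sums (H - h 0)"
      if "h sums H" for h :: "nat \<Rightarrow> real" and H
    proof -
      have "(\<lambda>n. h (Suc n)) sums (H - h 0)"
        using that by (simp add: sums_Suc_iff)
      then have "(\<lambda>m. \<Sum>n\<in>{m * 2..<m * 2 + 2}. h (Suc n)) sums (H - h 0)"
        by (rule sums_group) simp
      moreover have "(\<Sum>n\<in>{m * 2..<m * 2 + 2}. h (Suc n)) = h (2 * m + 1) + h (2 * m + 2)" for m
        by (simp add: mult.commute)
      ultimately show ?thesis by simp
    qed
    have "f (2 * m + 1) + f (2 * m + 2) \<le> g (2 * m + 1) + g (2 * m + 2)" for m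
    proof -
      define k where "k = real (2 * m + 2)"
      define c where "c = (p - 1) gchoose (2 * m + 1)"
      have k: "k \<ge> 2" by (simp add: k_def)
      have c: "0 \<le> c" unfolding c_def using p by (intro gbinomial_odd_nonneg) auto
      have "(p - 1) gchoose (2 * m + 2) = (p - k) / k * c"
        using gbinomial_Suc_ratio[of "p - 1" "2 * m + 1"] by (simp add: c_def k_def)
      moreover have "p gchoose (2 * m + 2) = p / k * c"
        using gbinomial_absorption[of "2 * m + 1" p] by (simp add: c_def k_def field_simps)
      moreover have wpow: "w ^ n = z powr (s * real n)" for n
        using powr_realpow[OF w(1), of n] by (simp add: w_def powr_powr)
      have "w ^ (2 * m + 1) = z powr (s * (k - 1))" "w ^ (2 * m + 2) = z powr (s * k)"
        "z ^ (2 * m + 2) = z powr k"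
        using 3 powr_realpow[of z "2 * m + 2"] unfolding wpow by (simp_all add: k_def)
      moreover have "z powr (s * (k - 1)) \<le> p / k * z powr k + (1 - p / k) * z powr (s * k)"
      proof -
        have "p / k * k + (1 - p / k) * (s * k) = s * (k - 1)"
          using p k unfolding s by (simp add: field_simps)
        moreover have "(z powr k) powr (p / k) * (z powr (s * k)) powr (1 - p / k) \<le>
            p / k * z powr k + (1 - p / k) * z powr (s * k)"
          using p k 3 by (intro Youngs_inequality_0) (auto simp: field_simps)
        ultimately show ?thesis by (simp only: powr_powr mult.commute flip: powr_add)
      qed
      then have "c * z powr (s * (k - 1)) \<le> c * (p / k * z powr k + (1 - p / k) * z powr (s * k))"
        using c by (rule mult_left_mono)
      moreover have "1 - p / k = - ((p - k) / k)" using k by (simp add: field_simps)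
      ultimately show ?thesis by (simp add: f_def g_def algebra_simps c_def)
    qed
    then have "(1 + w) powr (p - 1) - f 0 \<le> ((1 + z) powr p + (1 - z) powr p) / 2 - g 0"
      by (rule sums_le[OF _ pair[OF f] pair[OF g]])
    then show ?thesis by (simp add: f_def g_def w_def)
  qed
qed

lemma two_point_inequality_real:
  fixes a b s :: real
  assumes "2 \<le> s" "0 \<le> b" "b \<le> a"
  shows "(a + b) powr s + (a - b) powr s \<le> 2 * (a powr (s / (s - 1)) + b powr (s / (s - 1))) powr (s - 1)"
proof (cases "a = 0")
  case True
  then show ?thesis using assms by simp
next
  case False
  then have a: "a > 0" using assms by simp
  define p where "p = s / (s - 1)"
  have p: "1 < p" "p \<le> 2" "s = p / (p - 1)" "(p - 1) * (s - 1) = 1" "p * (s - 1) = s"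
    using assms unfolding p_def by (auto simp: field_simps)
  \<comment> \<open>In terms of \<open>z\<close> the roles of the pair \<open>a, b\<close> and of its Hadamard transform are exchanged.\<close>
  define z where "z = (a - b) / (a + b)"
  have z: "0 \<le> z" "z \<le> 1" "1 + z = 2 * a / (a + b)" "1 - z = 2 * b / (a + b)" "a - b = (a + b) * z"
    using a assms unfolding z_def by (auto simp: field_simps)
  have "1 + z powr s = ((1 + z powr s) powr (p - 1)) powr (s - 1)"
    using p by (simp add: powr_powr add_nonneg_nonneg)
  also have "\<dots> \<le> (((1 + z) powr p + (1 - z) powr p) / 2) powr (s - 1)"
    using assms by (intro powr_mono2 binomial_powr_comparison p z) auto
  also have "((1 + z) powr p + (1 - z) powr p) / 2 =
      2 powr (p - 1) * (a + b) powr - p * (a powr p + b powr p)"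
    unfolding z using a assms
    by (simp add: powr_divide powr_mult powr_diff powr_minus field_simps)
  also have "(\<dots>) powr (s - 1) = 2 * (a + b) powr - s * (a powr p + b powr p) powr (s - 1)"
    using p a by (simp add: powr_mult powr_powr)
  finally have "(a + b) powr s * (1 + z powr s) \<le>
      (a + b) powr s * (2 * (a + b) powr - s * (a powr p + b powr p) powr (s - 1))"
    by (intro mult_left_mono) auto
  also have "\<dots> = 2 * (a powr p + b powr p) powr (s - 1)"
    using a assms by (simp add: powr_minus)
  finally show ?thesis
    using a assms z(1) unfolding p_def z(5) by (simp add: powr_mult distrib_left)
qed

text \<open>
  Clarkson's inequality. By the parallelogram law \<open>(norm (a + b))\<^sup>2\<close> and \<open>(norm (a - b))\<^sup>2\<close> have the
  same sum as \<open>(norm a + norm b)\<^sup>2\<close> and \<open>(norm a - norm b)\<^sup>2\<close>, and they lie between these two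
  numbers; as \<open>t powr (s / 2)\<close> is convex, the scalar case is the extreme one.
\<close>

lemma two_point_inequality:
  fixes a b :: "'a::real_inner"
  assumes s: "2 \<le> s"
  shows "norm (a + b) powr s + norm (a - b) powr s \<le>
    2 * (norm a powr (s / (s - 1)) + norm b powr (s / (s - 1))) powr (s - 1)"
proof -
  have half: "x powr s = (x\<^sup>2) powr (s / 2)" if "0 \<le> x" for x :: real
  proof -
    have "(x\<^sup>2) powr (s / 2) = (x powr 2) powr (s / 2)" using that by (simp add: powr_numeral)
    then show ?thesis by (simp add: powr_powr)
  qed
  have wlog: "norm (a + b) powr s + norm (a - b) powr s \<le>
      2 * (norm a powr (s / (s - 1)) + norm b powr (s / (s - 1))) powr (s - 1)"
    if le: "norm b \<le> norm a" for a b :: 'a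
  proof -
    define M where "M = (norm a + norm b)\<^sup>2"
    define m where "m = (norm a - norm b)\<^sup>2"
    define u where "u = (norm (a + b))\<^sup>2"
    define v where "v = (norm (a - b))\<^sup>2"
    have m0: "0 \<le> m" unfolding m_def by simp
    have uv: "u + v = M + m"
      unfolding u_def v_def M_def m_def power2_sum power2_diff
      by (simp add: power2_norm_eq_inner inner_simps inner_commute)
    have "u \<le> M" "v \<le> M" unfolding u_def v_def M_def
      by (auto intro!: power_mono norm_triangle_ineq norm_triangle_ineq4)
    define l where "l = (if M = m then 1 else (u - m) / (M - m))"
    have l: "0 \<le> l" "l \<le> 1" "u = l * M + (1 - l) * m" "v = (1 - l) * M + (1 - (1 - l)) * m"
    proof -
      have "l * (M - m) = u - m" using \<open>u \<le> M\<close> \<open>v \<le> M\<close> uv unfolding l_def by simp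
      then show "u = l * M + (1 - l) * m" "v = (1 - l) * M + (1 - (1 - l)) * m"
        using uv by (simp_all add: algebra_simps)
      have "0 \<le> u - m" "u - m \<le> M - m" using \<open>u \<le> M\<close> \<open>v \<le> M\<close> uv by auto
      then show "0 \<le> l" "l \<le> 1" unfolding l_def by (auto simp: divide_le_eq)
    qed
    have "M \<ge> 0" unfolding M_def by simp
    have "u powr (s / 2) + v powr (s / 2) \<le> (l * M powr (s / 2) + (1 - l) * m powr (s / 2)) +
        ((1 - l) * M powr (s / 2) + (1 - (1 - l)) * m powr (s / 2))"
      unfolding l(3,4)
      by (intro add_mono powr_convex_combination) (use l s m0 \<open>M \<ge> 0\<close> in auto)
    also have "\<dots> = M powr (s / 2) + m powr (s / 2)" by (simp add: algebra_simps)
    also have "\<dots> = (norm a + norm b) powr s + (norm a - norm b) powr s"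
      using le by (simp add: half M_def m_def)
    also have "\<dots> \<le> 2 * (norm a powr (s / (s - 1)) + norm b powr (s / (s - 1))) powr (s - 1)"
      using s le by (intro two_point_inequality_real) auto
    finally show ?thesis by (simp add: half u_def v_def)
  qed
  show ?thesis
  proof (cases "norm b \<le> norm a")
    case True
    then show ?thesis by (rule wlog)
  next
    case False
    then show ?thesis using wlog[of a b] by (simp add: add.commute norm_minus_commute)
  qed
qed

section \<open>The spaces of p-summable sequences\<close>

lemma lp_norm_nonneg: "0 \<le> lp_norm p x"
  by (simp add: lp_norm_def)

lemma lp_norm_powr:
  assumes "0 < p" "x \<in> lp p"
  shows "lp_norm p x powr p = (\<Sum>k. norm (x k) powr p)"
  using assms by (simp add: lp_norm_def lp_def powr_powr suminf_nonneg)

text \<open>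
  Membership and norm bounds are conditions on finite partial sums, so all inequalities for sums
  over finite sets carry over to sequences.
\<close>

lemma lp_norm_le_iff:
  assumes "0 < p" "0 \<le> M"
  shows "x \<in> lp p \<and> lp_norm p x \<le> M \<longleftrightarrow> (\<forall>K. (\<Sum>k<K. norm (x k) powr p) \<le> M powr p)"
proof (intro iffI allI conjI)
  fix K assume x: "x \<in> lp p \<and> lp_norm p x \<le> M"
  have "(\<Sum>k<K. norm (x k) powr p) \<le> (\<Sum>k. norm (x k) powr p)"
    using x by (intro sum_le_suminf) (auto simp: lp_def)
  also have "\<dots> = lp_norm p x powr p" using lp_norm_powr x assms by metis
  also have "\<dots> \<le> M powr p" using x assms by (intro powr_mono2) (auto simp: lp_norm_nonneg)
  finally show "(\<Sum>k<K. norm (x k) powr p) \<le> M powr p" .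
next
  assume *: "\<forall>K. (\<Sum>k<K. norm (x k) powr p) \<le> M powr p"
  show x: "x \<in> lp p" unfolding lp_def
    by (simp, rule summableI_nonneg_bounded[where x = "M powr p"]) (use * in auto)
  then have "(\<Sum>k. norm (x k) powr p) \<le> M powr p"
    using * by (intro suminf_le_const) (auto simp: lp_def)
  then have "(\<Sum>k. norm (x k) powr p) powr (1 / p) \<le> (M powr p) powr (1 / p)"
    using assms x by (intro powr_mono2 suminf_nonneg) (auto simp: lp_def)
  then show "lp_norm p x \<le> M" using assms by (simp add: lp_norm_def powr_powr)
qed

lemmas lp_leI = lp_norm_le_iff[THEN iffD2, rule_format]

lemma lp_sum_le:
  assumes "0 < p" "x \<in> lp p" "finite F"
  shows "(\<Sum>k\<in>F. norm (x k) powr p) \<le> lp_norm p x powr p"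
  unfolding lp_norm_powr[OF assms(1,2)]
  using assms by (intro sum_le_suminf) (auto simp: lp_def)

lemma norm_le_lp_norm:
  assumes "0 < p" "x \<in> lp p"
  shows "norm (x k) \<le> lp_norm p x"
proof -
  have "norm (x k) powr p \<le> lp_norm p x powr p"
    using lp_sum_le[OF assms, of "{k}"] by simp
  then show ?thesis using assms(1) lp_norm_nonneg by (rule powr_le_powr_imp_le)
qed

text \<open>
  With \<open>M\<close> the \<open>p\<close>-norm this gives the inclusions between the spaces; with a smaller \<open>M\<close> it shows that
  they are small on flat vectors.
\<close>

lemma lp_norm_interpolation:
  assumes "0 < p" "p \<le> r" "x \<in> lp p" and M: "\<And>k. norm (x k) \<le> M"
  shows "x \<in> lp r" "lp_norm r x powr r \<le> M powr (r - p) * lp_norm p x powr p"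
proof -
  define C where "C = M powr (r - p) * lp_norm p x powr p"
  have C: "0 \<le> C" unfolding C_def by simp
  have "(\<Sum>k<K. norm (x k) powr r) \<le> C" for K
  proof -
    have "norm (x k) powr r \<le> M powr (r - p) * norm (x k) powr p" for k
    proof -
      have "norm (x k) powr r = norm (x k) powr (r - p) * norm (x k) powr p"
        by (simp flip: powr_add)
      also have "\<dots> \<le> M powr (r - p) * norm (x k) powr p"
        using assms by (intro mult_right_mono powr_mono2) auto
      finally show ?thesis .
    qed
    then have "(\<Sum>k<K. norm (x k) powr r) \<le> M powr (r - p) * (\<Sum>k<K. norm (x k) powr p)"
      unfolding sum_distrib_left by (intro sum_mono)
    also have "\<dots> \<le> C" unfolding C_def using assms by (intro mult_left_mono lp_sum_le) auto
    finally show ?thesis .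
  qed
  then have *: "x \<in> lp r \<and> lp_norm r x \<le> C powr (1 / r)"
    using assms C by (intro lp_leI) (auto simp: powr_powr)
  then show "x \<in> lp r" by simp
  have "lp_norm r x powr r \<le> (C powr (1 / r)) powr r"
    using * assms by (intro powr_mono2) (auto simp: lp_norm_nonneg)
  then show "lp_norm r x powr r \<le> M powr (r - p) * lp_norm p x powr p"
    using assms C by (simp add: powr_powr C_def)
qed

lemma lp_mono:
  assumes "0 < p" "p \<le> r" "x \<in> lp p"
  shows "x \<in> lp r" "lp_norm r x \<le> lp_norm p x"
proof -
  note I = lp_norm_interpolation[OF assms norm_le_lp_norm[OF assms(1,3)]]
  show "x \<in> lp r" by (rule I)
  have "lp_norm r x powr r \<le> lp_norm p x powr r"
    using I(2) by (simp flip: powr_add)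
  then show "lp_norm r x \<le> lp_norm p x"
    using assms by (auto intro: powr_le_powr_imp_le lp_norm_nonneg)
qed

lemma lp_add:
  assumes "1 \<le> p" "x \<in> lp p" "y \<in> lp p"
  shows "x + y \<in> lp p" "lp_norm p (x + y) \<le> lp_norm p x + lp_norm p y"
proof -
  have "(\<Sum>k<K. norm ((x + y) k) powr p) \<le> (lp_norm p x + lp_norm p y) powr p" for K
  proof -
    have "(\<Sum>k<K. norm ((x + y) k) powr p) \<le> (\<Sum>k<K. (norm (x k) + norm (y k)) powr p)"
      using assms by (intro sum_mono powr_mono2) (auto simp: norm_triangle_ineq)
    also have "\<dots> \<le> (lp_norm p x + lp_norm p y) powr p"
      using assms by (intro Minkowski_inequality_sum lp_sum_le) (auto simp: lp_norm_nonneg)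
    finally show ?thesis .
  qed
  then have "x + y \<in> lp p \<and> lp_norm p (x + y) \<le> lp_norm p x + lp_norm p y"
    using assms by (intro lp_leI) (auto simp: lp_norm_nonneg)
  then show "x + y \<in> lp p" "lp_norm p (x + y) \<le> lp_norm p x + lp_norm p y" by auto
qed

lemma lp_uminus:
  "- x \<in> lp p \<longleftrightarrow> x \<in> lp p" "lp_norm p (- x) = lp_norm p x"
  by (simp_all add: lp_def lp_norm_def)

lemma lp_diff:
  assumes "1 \<le> p" "x \<in> lp p" "y \<in> lp p"
  shows "x - y \<in> lp p" "lp_norm p (x - y) \<le> lp_norm p x + lp_norm p y"
  using lp_add[of p x "- y"] assms by (simp_all add: lp_uminus)

lemma lp_scale:
  fixes x :: "nat \<Rightarrow> 'a::real_normed_field"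
  assumes "0 < p" "x \<in> lp p"
  shows "seq_scale c x \<in> lp p" "lp_norm p (seq_scale c x) = norm c * lp_norm p x"
proof -
  have *: "norm (seq_scale c x k) powr p = norm c powr p * norm (x k) powr p" for k
    by (simp add: seq_scale_def norm_mult powr_mult)
  have s: "summable (\<lambda>k. norm (x k) powr p)" using assms by (simp add: lp_def)
  then show "seq_scale c x \<in> lp p" by (simp add: lp_def * summable_mult)
  show "lp_norm p (seq_scale c x) = norm c * lp_norm p x"
    unfolding lp_norm_def * suminf_mult[OF s]
    using assms s by (simp add: powr_mult powr_powr suminf_nonneg)
qed

lemma lp_finite_support:
  assumes "0 < p" "finite F" "\<And>k. k \<notin> F \<Longrightarrow> x k = 0"
  shows "x \<in> lp p" "lp_norm p x = (\<Sum>k\<in>F. norm (x k) powr p) powr (1 / p)"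
proof -
  have "(\<lambda>k. norm (x k) powr p) sums (\<Sum>k\<in>F. norm (x k) powr p)"
    using assms by (intro sums_finite) auto
  then show "x \<in> lp p" "lp_norm p x = (\<Sum>k\<in>F. norm (x k) powr p) powr (1 / p)"
    by (auto simp: lp_def lp_norm_def sums_iff)
qed

lemma lp_norm_eq_0_iff:
  assumes "0 < p" "x \<in> lp p"
  shows "lp_norm p x = 0 \<longleftrightarrow> x = 0"
proof
  assume "lp_norm p x = 0"
  then show "x = 0" using norm_le_lp_norm[OF assms] by (auto simp: fun_eq_iff)
next
  assume "x = 0"
  then show "lp_norm p x = 0" using assms by (simp add: lp_norm_def)
qed

lemma Metric_space_lp:
  assumes "1 \<le> p"
  shows "Metric_space (lp p) (\<lambda>x y. lp_norm p (x - y))"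
proof
  fix x y z :: "nat \<Rightarrow> 'a"
  show "0 \<le> lp_norm p (x - y)" by (rule lp_norm_nonneg)
  show "lp_norm p (x - y) = lp_norm p (y - x)"
    using lp_uminus(2)[of p "x - y"] by simp
  assume xy: "x \<in> lp p" "y \<in> lp p"
  then show "lp_norm p (x - y) = 0 \<longleftrightarrow> x = y"
    using assms by (subst lp_norm_eq_0_iff) (auto intro: lp_diff)
  assume "z \<in> lp p"
  with xy have "x - y \<in> lp p" "y - z \<in> lp p" using lp_diff assms by auto
  from lp_add(2)[OF assms this] show "lp_norm p (x - z) \<le> lp_norm p (x - y) + lp_norm p (y - z)"
    by simp
qed

lemma lp_tendsto_0:
  assumes "0 < p" "x \<in> lp p"
  shows "x \<longlonglongrightarrow> 0"
proof -
  have "(\<lambda>k. (norm (x k) powr p) powr (1 / p)) \<longlonglongrightarrow> 0 powr (1 / p)"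
    using assms by (intro tendsto_powr' summable_LIMSEQ_zero) (auto simp: lp_def)
  then have "(\<lambda>k. norm (x k)) \<longlonglongrightarrow> 0" using assms by (simp add: powr_powr)
  then show ?thesis by (rule tendsto_norm_zero_cancel)
qed

definition truncate_seq :: "nat \<Rightarrow> (nat \<Rightarrow> 'a::zero) \<Rightarrow> nat \<Rightarrow> 'a" where
  "truncate_seq K x = (\<lambda>k. if k < K then x k else 0)"

lemma lp_truncate_seq:
  assumes "0 < p"
  shows "truncate_seq K x \<in> lp p"
  by (rule lp_finite_support[OF assms, of "{..<K}"]) (auto simp: truncate_seq_def)

lemma truncate_seq_tendsto:
  assumes "0 < p" "x \<in> lp p"
  shows "(\<lambda>K. lp_norm p (x - truncate_seq K x)) \<longlonglongrightarrow> 0"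
proof -
  have s: "summable (\<lambda>k. norm (x k) powr p)" using assms by (simp add: lp_def)
  have tail: "(\<Sum>k. norm ((x - truncate_seq K x) k) powr p) = (\<Sum>k. norm (x (k + K)) powr p)" for K
  proof -
    have "(\<lambda>k. norm (x (k + K)) powr p) sums (\<Sum>k. norm (x (k + K)) powr p)"
      using s by (intro summable_sums) (subst summable_iff_shift)
    then have "(\<lambda>k. norm ((x - truncate_seq K x) (k + K)) powr p) sums
        (\<Sum>k. norm (x (k + K)) powr p)"
      by (simp add: truncate_seq_def)
    then have "(\<lambda>k. norm ((x - truncate_seq K x) k) powr p) sums
        ((\<Sum>k. norm (x (k + K)) powr p) + (\<Sum>k<K. norm ((x - truncate_seq K x) k) powr p))"
      by (subst (asm) sums_iff_shift)
    moreover have "(\<Sum>k<K. norm ((x - truncate_seq K x) k) powr p) = 0"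
      by (simp add: truncate_seq_def)
    ultimately show ?thesis by (simp add: sums_iff)
  qed
  have "(\<lambda>K. (\<Sum>k. norm (x (k + K)) powr p)) \<longlonglongrightarrow> 0"
    using suminf_exist_split2[OF s] .
  then have "(\<lambda>K. (\<Sum>k. norm (x (k + K)) powr p) powr (1 / p)) \<longlonglongrightarrow> 0 powr (1 / p)"
    using assms s by (intro tendsto_powr')
      (auto intro!: always_eventually suminf_nonneg
        simp: summable_ignore_initial_segment[of "\<lambda>k. norm (x k) powr p"])
  then show ?thesis unfolding lp_norm_def tail by simp
qed

definition unit_seq :: "nat \<Rightarrow> nat \<Rightarrow> 'a::zero_neq_one" where
  "unit_seq j = (\<lambda>k. if k = j then 1 else 0)"

lemma lp_unit_seq:
  assumes "0 < p"
  shows "(unit_seq j :: nat \<Rightarrow> 'a::real_normed_field) \<in> lp p"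
    "lp_norm p (unit_seq j :: nat \<Rightarrow> 'a) = 1"
proof -
  note * = lp_finite_support[OF assms, of "{j}" "unit_seq j :: nat \<Rightarrow> 'a"]
  show "(unit_seq j :: nat \<Rightarrow> 'a) \<in> lp p" by (rule *) (auto simp: unit_seq_def)
  show "lp_norm p (unit_seq j :: nat \<Rightarrow> 'a) = 1" by (subst *) (auto simp: unit_seq_def)
qed

lemma finite_support_unit_seq_expansion:
  fixes x :: "nat \<Rightarrow> 'a::field"
  assumes "finite F" "\<And>k. k \<notin> F \<Longrightarrow> x k = 0"
  shows "x = (\<Sum>j\<in>F. seq_scale (x j) (unit_seq j))"
proof
  fix k
  have "(\<Sum>j\<in>F. seq_scale (x j) (unit_seq j)) k = (\<Sum>j\<in>F. if k = j then x j else 0)"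
    using assms(1) by (induction F rule: finite_induct) (auto simp: seq_scale_def unit_seq_def)
  then show "x k = (\<Sum>j\<in>F. seq_scale (x j) (unit_seq j)) k"
    using assms by (auto simp: sum.delta)
qed

section \<open>Bounded operators\<close>

interpretation seq: vector_space "seq_scale :: 'a::field \<Rightarrow> (nat \<Rightarrow> 'a) \<Rightarrow> nat \<Rightarrow> 'a"
  by (rule vector_space_seq_scale)

lemma bounded_op_bound:
  assumes "bounded_op p q T"
  obtains C where "0 \<le> C" "\<And>x. x \<in> lp p \<Longrightarrow> lp_norm q (T x) \<le> C * lp_norm p x"
proof -
  obtain C where C: "\<And>x. x \<in> lp p \<Longrightarrow> lp_norm q (T x) \<le> C * lp_norm p x"
    using assms unfolding bounded_op_def by blast
  have "lp_norm q (T x) \<le> max C 0 * lp_norm p x" if "x \<in> lp p" for x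
    using C[OF that] mult_right_mono[of C "max C 0" "lp_norm p x"] by (simp add: lp_norm_nonneg)
  then show ?thesis using that[of "max C 0"] by auto
qed

lemma bounded_op_zero:
  fixes T :: "(nat \<Rightarrow> 'a::real_normed_field) \<Rightarrow> nat \<Rightarrow> 'a"
  assumes "bounded_op p q T"
  shows "T 0 = 0"
proof -
  have "0 \<in> lp p" by (simp add: lp_def)
  then have "T (seq_scale 0 0) = seq_scale 0 (T 0)"
    using assms unfolding bounded_op_def by blast
  then show ?thesis by simp
qed

lemma bounded_op_sum:
  fixes T :: "(nat \<Rightarrow> 'a::real_normed_field) \<Rightarrow> nat \<Rightarrow> 'a"
  assumes T: "bounded_op p q T" and p: "1 \<le> p" and x: "\<And>j. j \<in> F \<Longrightarrow> x j \<in> lp p"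
  shows "(\<Sum>j\<in>F. seq_scale (c j) (x j)) \<in> lp p"
    and "T (\<Sum>j\<in>F. seq_scale (c j) (x j)) = (\<Sum>j\<in>F. seq_scale (c j) (T (x j)))"
proof -
  have "(\<Sum>j\<in>F. seq_scale (c j) (x j)) \<in> lp p \<and>
      T (\<Sum>j\<in>F. seq_scale (c j) (x j)) = (\<Sum>j\<in>F. seq_scale (c j) (T (x j)))"
    using x
  proof (induction F rule: infinite_finite_induct)
    case (insert j F)
    then have "seq_scale (c j) (x j) \<in> lp p" using p by (intro lp_scale) auto
    moreover have F: "(\<Sum>j\<in>F. seq_scale (c j) (x j)) \<in> lp p"
      "T (\<Sum>j\<in>F. seq_scale (c j) (x j)) = (\<Sum>j\<in>F. seq_scale (c j) (T (x j)))"
      using insert by auto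
    moreover have "T (seq_scale (c j) (x j)) = seq_scale (c j) (T (x j))"
      using T insert.prems unfolding bounded_op_def by blast
    ultimately have "T (seq_scale (c j) (x j) + (\<Sum>j\<in>F. seq_scale (c j) (x j))) =
        seq_scale (c j) (T (x j)) + (\<Sum>j\<in>F. seq_scale (c j) (T (x j)))"
      "seq_scale (c j) (x j) + (\<Sum>j\<in>F. seq_scale (c j) (x j)) \<in> lp p"
      using T p lp_add(1) unfolding bounded_op_def by metis+
    then show ?case unfolding sum.insert[OF insert.hyps] by blast
  qed (use bounded_op_zero[OF T] in \<open>auto simp: lp_def\<close>)
  then show "(\<Sum>j\<in>F. seq_scale (c j) (x j)) \<in> lp p"
    "T (\<Sum>j\<in>F. seq_scale (c j) (x j)) = (\<Sum>j\<in>F. seq_scale (c j) (T (x j)))" by auto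
qed

lemma sum_seq_apply:
  fixes x :: "'i \<Rightarrow> nat \<Rightarrow> 'a::field"
  shows "(\<Sum>j\<in>F. seq_scale (c j) (x j)) k = (\<Sum>j\<in>F. c j * x j k)"
  by (induction F rule: infinite_finite_induct) (auto simp: seq_scale_def)

lemma bounded_op_finite_support:
  fixes T :: "(nat \<Rightarrow> 'a::real_normed_field) \<Rightarrow> nat \<Rightarrow> 'a"
  assumes T: "bounded_op p q T" and p: "1 \<le> p" and F: "finite F" "\<And>k. k \<notin> F \<Longrightarrow> x k = 0"
  shows "T x i = (\<Sum>j\<in>F. x j * T (unit_seq j) i)"
proof -
  have "T x = T (\<Sum>j\<in>F. seq_scale (x j) (unit_seq j))"
    using finite_support_unit_seq_expansion[OF F] by simp
  also have "\<dots> = (\<Sum>j\<in>F. seq_scale (x j) (T (unit_seq j)))"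
    using p by (intro bounded_op_sum(2)[OF T p] lp_unit_seq) auto
  finally show ?thesis by (simp add: sum_seq_apply)
qed

lemma bounded_op_coordinate_truncate:
  fixes T :: "(nat \<Rightarrow> 'a::real_normed_field) \<Rightarrow> nat \<Rightarrow> 'a"
  assumes T: "bounded_op p q T" and p: "1 \<le> p" and q: "1 \<le> q" and x: "x \<in> lp p"
  shows "(\<lambda>K. \<Sum>k<K. x k * T (unit_seq k) i) \<longlonglongrightarrow> T x i"
proof -
  obtain C where C: "0 \<le> C" "\<And>x. x \<in> lp p \<Longrightarrow> lp_norm q (T x) \<le> C * lp_norm p x"
    using bounded_op_bound[OF T] by blast
  have *: "T (truncate_seq K x) i = (\<Sum>k<K. x k * T (unit_seq k) i)" for K
    using bounded_op_finite_support[OF T p, of "{..<K}" "truncate_seq K x" i]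
    by (simp add: truncate_seq_def)
  have le: "norm (T (truncate_seq K x) i - T x i) \<le> C * lp_norm p (x - truncate_seq K x)" for K
  proof -
    have tr: "truncate_seq K x \<in> lp p" "x - truncate_seq K x \<in> lp p"
      using lp_truncate_seq[of p K x] lp_diff(1)[OF p x] p by auto
    have "T (truncate_seq K x + (x - truncate_seq K x)) = T (truncate_seq K x) + T (x - truncate_seq K x)"
      using T tr unfolding bounded_op_def by blast
    then have "T (x - truncate_seq K x) i = - (T (truncate_seq K x) i - T x i)"
      by (subst (asm) add.commute) simp
    then have "norm (T (truncate_seq K x) i - T x i) = norm (T (x - truncate_seq K x) i)"
      by (metis norm_minus_cancel)
    also have "\<dots> \<le> lp_norm q (T (x - truncate_seq K x))"
      using T tr q unfolding bounded_op_def by (intro norm_le_lp_norm) auto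
    also have "\<dots> \<le> C * lp_norm p (x - truncate_seq K x)" using C tr by auto
    finally show ?thesis .
  qed
  have lim: "(\<lambda>K. C * lp_norm p (x - truncate_seq K x)) \<longlonglongrightarrow> 0"
    using tendsto_mult[OF tendsto_const truncate_seq_tendsto[of p x], of C] p x by simp
  have "(\<lambda>K. T (truncate_seq K x) i - T x i) \<longlonglongrightarrow> 0"
    by (rule Lim_null_comparison[OF always_eventually lim]) (use le in blast)
  then show ?thesis unfolding * by (simp add: LIM_zero_iff)
qed

lemma lp_norm_le_op_norm:
  fixes T :: "(nat \<Rightarrow> 'a::real_normed_field) \<Rightarrow> nat \<Rightarrow> 'a"
  assumes C: "\<And>x. x \<in> lp p \<Longrightarrow> lp_norm q (T x) \<le> C * lp_norm p x" "0 \<le> C"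
    and x: "x \<in> lp p" "lp_norm p x \<le> 1"
  shows "lp_norm q (T x) \<le> op_norm p q T"
  unfolding op_norm_def
proof (rule cSUP_upper)
  show "bdd_above ((\<lambda>x. lp_norm q (T x)) ` {x \<in> lp p. lp_norm p x \<le> 1})"
  proof (rule bdd_aboveI2)
    fix x :: "nat \<Rightarrow> 'a" assume "x \<in> {x \<in> lp p. lp_norm p x \<le> 1}"
    then have "x \<in> lp p" "C * lp_norm p x \<le> C" using C(2) by (auto intro: mult_left_le)
    then show "lp_norm q (T x) \<le> C" using C(1) by fastforce
  qed
qed (use x in auto)

lemma lp_norm_diff_le_op_norm:
  fixes T S :: "(nat \<Rightarrow> 'a::real_normed_field) \<Rightarrow> nat \<Rightarrow> 'a"
  assumes T: "bounded_op p q T" and S: "bounded_op p q S" and q: "1 \<le> q"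
    and p: "0 < p" and x: "x \<in> lp p"
  shows "lp_norm q (T x - S x) \<le> op_norm p q (\<lambda>x. T x - S x) * lp_norm p x"
proof (cases "x = 0")
  case True
  then show ?thesis
    using bounded_op_zero[OF T] bounded_op_zero[OF S] p q by (simp add: lp_norm_def)
next
  case False
  obtain C where C: "0 \<le> C" "\<And>x. x \<in> lp p \<Longrightarrow> lp_norm q (T x) \<le> C * lp_norm p x"
    using bounded_op_bound[OF T] by blast
  obtain D where D: "0 \<le> D" "\<And>x. x \<in> lp p \<Longrightarrow> lp_norm q (S x) \<le> D * lp_norm p x"
    using bounded_op_bound[OF S] by blast
  define N where "N = lp_norm p x"
  have N: "0 < N"
    unfolding N_def using lp_norm_eq_0_iff[OF p x] False lp_norm_nonneg[of p x] by linarith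
  define y where "y = seq_scale (of_real (1 / N)) x"
  have y: "y \<in> lp p" "lp_norm p y = 1"
    unfolding y_def using lp_scale[OF p x] N by (simp_all add: N_def norm_divide)
  have TSx: "T x - S x \<in> lp q"
    using T S x unfolding bounded_op_def by (intro lp_diff[OF q]) auto
  have "T y - S y = seq_scale (of_real (1 / N)) (T x - S x)"
  proof -
    have "T y = seq_scale (of_real (1 / N)) (T x)" "S y = seq_scale (of_real (1 / N)) (S x)"
      unfolding y_def using T S x unfolding bounded_op_def by blast+
    then show ?thesis by (simp only: seq.scale_right_diff_distrib)
  qed
  then have eq: "lp_norm q (T y - S y) = lp_norm q (T x - S x) / N"
    using lp_scale(2)[OF _ TSx, of "of_real (1 / N)"] q N by (simp add: norm_divide)
  have "lp_norm q (T y - S y) \<le> op_norm p q (\<lambda>x. T x - S x)"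
  proof (rule lp_norm_le_op_norm[where C = "C + D"])
    fix x :: "nat \<Rightarrow> 'a" assume x: "x \<in> lp p"
    have "lp_norm q (T x - S x) \<le> lp_norm q (T x) + lp_norm q (S x)"
      using T S x q unfolding bounded_op_def by (intro lp_diff) auto
    also have "\<dots> \<le> (C + D) * lp_norm p x" using C D x by (simp add: add_mono distrib_right)
    finally show "lp_norm q (T x - S x) \<le> (C + D) * lp_norm p x" .
  qed (use C D y in auto)
  then show ?thesis using N unfolding eq N_def[symmetric] by (simp add: field_simps)
qed

section \<open>Hadamard matrices\<close>

lemma abs_hadamard: "\<bar>hadamard n i j\<bar> = 1"
  by (induction n arbitrary: i j) auto

lemma hadamard_mult_self: "hadamard n i j * hadamard n i j = 1"
  using abs_hadamard[of n i j] by (auto simp: abs_if split: if_splits)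

lemma hadamard_commute: "hadamard n i j = hadamard n j i"
  by (induction n arbitrary: i j) auto

lemma sum_lessThan_add:
  fixes f :: "nat \<Rightarrow> 'b::comm_monoid_add"
  shows "(\<Sum>k<a + b. f k) = (\<Sum>k<a. f k) + (\<Sum>k<b. f (a + k))"
  by (induction b) (simp_all add: add.assoc)

text \<open>
  The induction step uses that the matrix of order \<open>2 ^ Suc n\<close> is the tensor product of the one of
  order \<open>2\<close>, which is the two-point inequality, with the one of order \<open>2 ^ n\<close>. Bounds from the
  \<open>p\<close>-norm to the \<open>s\<close>-norm multiply in tensor products since \<open>p \<le> s\<close>; this is the use of
  Minkowski's inequality with exponent \<open>s / p = s - 1\<close>.
\<close>

lemma Hausdorff_Young_hadamard:
  fixes v :: "nat \<Rightarrow> 'a::real_inner"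
  assumes s: "2 \<le> s"
  shows "(\<Sum>i<2 ^ n. norm (\<Sum>j<2 ^ n. hadamard n i j *\<^sub>R v j) powr s) \<le>
    2 ^ n * (\<Sum>j<2 ^ n. norm (v j) powr (s / (s - 1))) powr (s - 1)"
proof (induction n arbitrary: v)
  case 0
  show ?case using s by (simp add: powr_powr)
next
  case (Suc n)
  define p where "p = s / (s - 1)"
  have ps: "p * (s - 1) = s" using s by (simp add: p_def)
  define N :: nat where "N = 2 ^ n"
  define H where "H u i = (\<Sum>j<N. hadamard n i j *\<^sub>R u j)" for u :: "nat \<Rightarrow> 'a" and i
  define w where "w j = v (N + j)" for j
  define X where "X = (\<Sum>j<N. norm (v j) powr p)"
  define Y where "Y = (\<Sum>j<N. norm (w j) powr p)"
  have XY: "0 \<le> X" "0 \<le> Y" unfolding X_def Y_def by (auto intro: sum_nonneg)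
  define c where "c = real N powr (1 / (s - 1))"
  have c: "0 \<le> c" "c powr (s - 1) = real N" using s by (auto simp: c_def powr_powr)
  have IH: "(\<Sum>i<N. norm (H u i) powr s) \<le> real N * (\<Sum>j<N. norm (u j) powr p) powr (s - 1)" for u
    using Suc.IH[of u] unfolding H_def N_def p_def by simp
  have low: "(\<Sum>j<2 ^ Suc n. hadamard (Suc n) i j *\<^sub>R v j) = H v i + H w i"
    and high: "(\<Sum>j<2 ^ Suc n. hadamard (Suc n) (N + i) j *\<^sub>R v j) = H v i - H w i"
    if "i < N" for i
    using that by (auto simp: H_def w_def N_def mult_2 sum_lessThan_add sum_negf)
  have "(\<Sum>i<2 ^ Suc n. norm (\<Sum>j<2 ^ Suc n. hadamard (Suc n) i j *\<^sub>R v j) powr s) =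
      (\<Sum>i<N + N. norm (\<Sum>j<2 ^ Suc n. hadamard (Suc n) i j *\<^sub>R v j) powr s)"
    by (simp add: N_def mult_2)
  also have "\<dots> = (\<Sum>i<N. norm (H v i + H w i) powr s + norm (H v i - H w i) powr s)"
    unfolding sum_lessThan_add sum.distrib
    by (intro arg_cong2[where f = "(+)"] sum.cong refl; subst low high; simp)
  also have "\<dots> \<le> (\<Sum>i<N. 2 * (norm (H v i) powr p + norm (H w i) powr p) powr (s - 1))"
    unfolding p_def by (intro sum_mono two_point_inequality s)
  also have "\<dots> = 2 * (\<Sum>i<N. (norm (H v i) powr p + norm (H w i) powr p) powr (s - 1))"
    by (simp add: sum_distrib_left)
  also have "\<dots> \<le> 2 * (c * X + c * Y) powr (s - 1)"
  proof (intro mult_left_mono Minkowski_inequality_sum)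
    show "(\<Sum>i<N. (norm (H v i) powr p) powr (s - 1)) \<le> (c * X) powr (s - 1)"
      using IH[of v] XY c by (simp add: powr_powr ps powr_mult X_def)
    show "(\<Sum>i<N. (norm (H w i) powr p) powr (s - 1)) \<le> (c * Y) powr (s - 1)"
      using IH[of w] XY c by (simp add: powr_powr ps powr_mult Y_def)
  qed (use s XY c in auto)
  also have "\<dots> = 2 ^ Suc n * (X + Y) powr (s - 1)"
    using XY c by (simp add: powr_mult N_def flip: distrib_left)
  also have "X + Y = (\<Sum>j<2 ^ Suc n. norm (v j) powr p)"
    by (simp add: X_def Y_def w_def N_def mult_2 sum_lessThan_add)
  finally show ?case unfolding p_def .
qed

text \<open>
  The triangle inequality bounds the Hadamard combinations of \<open>N\<close> sequences of \<open>t\<close>-norm at most \<open>M\<close>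
  only by \<open>N * M\<close>; in the mean of order \<open>t\<close> the factor \<open>N\<close> improves to
  \<open>N powr max (1 / t) (1 - 1 / t)\<close>, by the Hausdorff-Young inequality in every coordinate \<open>k\<close>.
\<close>

lemma hadamard_transform_rows_bound:
  fixes c :: "nat \<Rightarrow> nat \<Rightarrow> 'a::real_inner"
  assumes t: "1 < t" and M: "0 \<le> M"
    and c: "\<And>j. j < 2 ^ n \<Longrightarrow> (\<Sum>k<K. norm (c j k) powr t) \<le> M powr t"
  shows "(\<Sum>i<2 ^ n. \<Sum>k<K. norm (\<Sum>j<2 ^ n. hadamard n i j *\<^sub>R c j k) powr t) \<le>
    real (2 ^ n) powr (1 + max 1 (t - 1)) * M powr t"
proof -
  define N :: nat where "N = 2 ^ n"
  have N: "0 < real N" by (simp add: N_def)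
  define H where "H u i = (\<Sum>j<N. hadamard n i j *\<^sub>R u j)" for u :: "nat \<Rightarrow> 'a" and i
  have key: "(\<Sum>i<N. norm (H u i) powr t) \<le> real N powr max 1 (t - 1) * (\<Sum>j<N. norm (u j) powr t)"
    for u
  proof (cases "2 \<le> t")
    case True
    define p where "p = t / (t - 1)"
    have p: "0 < p" "p * (t - 1) = t" using True by (auto simp: p_def)
    have "(\<Sum>i<N. norm (H u i) powr t) \<le> real N * (\<Sum>j<N. norm (u j) powr p) powr (t - 1)"
      using Hausdorff_Young_hadamard[OF True, where n = n and v = u] by (simp add: H_def N_def p_def)
    also have "\<dots> \<le> real N * (real N powr (t - 1 - 1) * (\<Sum>j<N. (norm (u j) powr p) powr (t - 1)))"
      using power_mean_inequality[of "t - 1" "{..<N}" "\<lambda>j. norm (u j) powr p"] True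
      by (intro mult_left_mono) auto
    also have "\<dots> = real N powr max 1 (t - 1) * (\<Sum>j<N. norm (u j) powr t)"
    proof -
      have "real N * real N powr (t - 1 - 1) = real N powr (t - 1)"
        using powr_add[of "real N" 1 "t - 1 - 1"] N by simp
      moreover have "max 1 (t - 1) = t - 1" using True by simp
      ultimately show ?thesis by (simp only: powr_powr p mult.assoc[symmetric])
    qed
    finally show ?thesis .
  next
    case False
    \<comment> \<open>For \<open>t < 2\<close> the bound passes through the Euclidean norm.\<close>
    have "(\<Sum>i<N. (norm (H u i) powr t)) powr (2 / t) \<le>
        real (card {..<N}) powr (2 / t - 1) * (\<Sum>i<N. (norm (H u i) powr t) powr (2 / t))"
      using False t by (intro power_mean_inequality) auto
    also have "(\<Sum>i<N. (norm (H u i) powr t) powr (2 / t)) = (\<Sum>i<N. norm (H u i) powr 2)"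
      using t by (simp add: powr_powr)
    also have "real (card {..<N}) powr (2 / t - 1) * \<dots> \<le>
        real N powr (2 / t - 1) * (real N * (\<Sum>j<N. norm (u j) powr 2))"
      using Hausdorff_Young_hadamard[of 2, where n = n and v = u]
      by (intro mult_mono) (auto simp: H_def N_def sum_nonneg)
    also have "\<dots> = real N powr (2 / t) * (\<Sum>j<N. norm (u j) powr 2)"
      using N by (simp add: powr_diff)
    also have "(\<Sum>j<N. norm (u j) powr 2) = (\<Sum>j<N. (norm (u j) powr t) powr (2 / t))"
      using t by (simp add: powr_powr)
    also have "real N powr (2 / t) * \<dots> \<le> real N powr (2 / t) * (\<Sum>j<N. norm (u j) powr t) powr (2 / t)"
      using False t by (intro mult_left_mono sum_powr_le_powr_sum) auto
    also have "\<dots> = (real N * (\<Sum>j<N. norm (u j) powr t)) powr (2 / t)"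
      by (simp add: powr_mult sum_nonneg)
    finally have "(\<Sum>i<N. norm (H u i) powr t) \<le> real N * (\<Sum>j<N. norm (u j) powr t)"
      by (rule powr_le_powr_imp_le) (use t in \<open>auto intro!: mult_nonneg_nonneg sum_nonneg\<close>)
    then show ?thesis using False N by (simp add: max_def)
  qed
  have "(\<Sum>i<N. \<Sum>k<K. norm (H (\<lambda>j. c j k) i) powr t) =
      (\<Sum>k<K. \<Sum>i<N. norm (H (\<lambda>j. c j k) i) powr t)"
    by (rule sum.swap)
  also have "\<dots> \<le> (\<Sum>k<K. real N powr max 1 (t - 1) * (\<Sum>j<N. norm (c j k) powr t))"
    by (intro sum_mono key)
  also have "\<dots> = real N powr max 1 (t - 1) * (\<Sum>j<N. \<Sum>k<K. norm (c j k) powr t)"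
    unfolding sum_distrib_left[symmetric] by (subst sum.swap) simp
  also have "\<dots> \<le> real N powr max 1 (t - 1) * (\<Sum>j<N. M powr t)"
    using c by (intro mult_left_mono sum_mono) (auto simp: N_def)
  also have "\<dots> = real N powr (1 + max 1 (t - 1)) * M powr t"
    using N by (simp add: powr_add)
  finally show ?thesis by (simp add: H_def N_def)
qed

section \<open>The block operator\<close>

text \<open>
  The exponents \<open>p\<close> and \<open>q\<close> enter the block Hadamard operator only through \<open>s = min p' q\<close>. As a
  function of \<open>s\<close> alone, the operator can be studied between other pairs of sequence spaces.
\<close>

definition scaled_hadamard_op :: "real \<Rightarrow> (nat \<Rightarrow> 'a::real_vector) \<Rightarrow> nat \<Rightarrow> 'a" where
  "scaled_hadamard_op s x k =
     (let n = block_of k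
      in real (2 ^ n) powr (- 1 / s) *\<^sub>R
         (\<Sum>j<2 ^ n. hadamard n (k - block_start n) j *\<^sub>R x (block_start n + j)))"

lemma hadamard_op_eq_scaled:
  "hadamard_op p q = scaled_hadamard_op (real_of_ereal (min (conj_exp p) (ereal q)))"
  by (simp add: fun_eq_iff hadamard_op_def scaled_hadamard_op_def hadamard_block_def Let_def)

lemma scaled_hadamard_op_block:
  assumes "1 \<le> n" "i < 2 ^ n"
  shows "scaled_hadamard_op s x (block_start n + i) = real (2 ^ n) powr (- 1 / s) *\<^sub>R
    (\<Sum>j<2 ^ n. hadamard n i j *\<^sub>R x (block_start n + j))"
  using assms by (simp add: scaled_hadamard_op_def block_of_block_start)

lemma block_start_Suc: "1 \<le> n \<Longrightarrow> block_start (Suc n) = block_start n + 2 ^ n"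
  by (simp add: block_start_def)

lemma le_block_start_Suc: "n \<le> block_start (Suc n)"
proof (induction n)
  case (Suc n)
  have "1 \<le> (2::nat) ^ Suc n" by simp
  then show ?case using Suc block_start_Suc[of "Suc n"] by linarith
qed simp

lemma block_of_ge_1: "1 \<le> block_of k"
proof -
  have "k < block_start (Suc (Suc k))" using le_block_start_Suc[of "Suc k"] by simp
  then have "k < block_start (Suc (block_of k))" unfolding block_of_def by (rule LeastI)
  then show ?thesis by (cases "block_of k") (auto simp: block_start_def)
qed

lemma sum_over_blocks:
  fixes f :: "nat \<Rightarrow> 'b::comm_monoid_add"
  shows "(\<Sum>k<block_start (Suc m). f k) = (\<Sum>n=1..m. \<Sum>i<2 ^ n. f (block_start n + i))"
proof (induction m)
  case 0
  show ?case by (simp add: block_start_def)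
next
  case (Suc m)
  then show ?case using block_start_Suc[of "Suc m"] by (simp add: sum_lessThan_add)
qed

lemma scaled_hadamard_op_contraction:
  fixes x :: "nat \<Rightarrow> 'a::real_inner"
  assumes s: "2 \<le> s" and x: "x \<in> lp (s / (s - 1))"
  shows "scaled_hadamard_op s x \<in> lp s"
    "lp_norm s (scaled_hadamard_op s x) \<le> lp_norm (s / (s - 1)) x"
proof -
  define p where "p = s / (s - 1)"
  have p: "0 < p" "p * (s - 1) = s" using s by (auto simp: p_def)
  define X where "X n = (\<Sum>j<2 ^ n. norm (x (block_start n + j)) powr p)" for n
  have block: "(\<Sum>i<2 ^ n. norm (scaled_hadamard_op s x (block_start n + i)) powr s) \<le> X n powr (s - 1)"
    if "1 \<le> n" for n
  proof -
    have "(\<Sum>i<2 ^ n. norm (scaled_hadamard_op s x (block_start n + i)) powr s) =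
      (\<Sum>i<2 ^ n. real (2 ^ n) powr - 1 *
        norm (\<Sum>j<2 ^ n. hadamard n i j *\<^sub>R x (block_start n + j)) powr s)"
      using that s by (simp add: scaled_hadamard_op_block powr_mult powr_powr)
    also have "\<dots> = real (2 ^ n) powr - 1 *
        (\<Sum>i<2 ^ n. norm (\<Sum>j<2 ^ n. hadamard n i j *\<^sub>R x (block_start n + j)) powr s)"
      by (simp add: sum_distrib_left)
    also have "\<dots> \<le> real (2 ^ n) powr - 1 * (2 ^ n * X n powr (s - 1))"
      unfolding X_def p_def by (intro mult_left_mono Hausdorff_Young_hadamard s) auto
    also have "\<dots> = X n powr (s - 1)" by (simp add: powr_minus)
    finally show ?thesis .
  qed
  have "(\<Sum>k<K. norm (scaled_hadamard_op s x k) powr s) \<le> lp_norm p x powr s" for K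
  proof -
    have "(\<Sum>k<K. norm (scaled_hadamard_op s x k) powr s) \<le>
        (\<Sum>k<block_start (Suc K). norm (scaled_hadamard_op s x k) powr s)"
      using le_block_start_Suc[of K] by (intro sum_mono2) auto
    also have "\<dots> \<le> (\<Sum>n=1..K. X n powr (s - 1))"
      unfolding sum_over_blocks by (intro sum_mono block) auto
    also have "\<dots> \<le> (\<Sum>n=1..K. X n) powr (s - 1)"
      using s by (intro sum_powr_le_powr_sum) (auto simp: X_def sum_nonneg)
    also have "\<dots> = (\<Sum>k<block_start (Suc K). norm (x k) powr p) powr (s - 1)"
      by (simp add: sum_over_blocks X_def)
    also have "\<dots> \<le> (lp_norm p x powr p) powr (s - 1)"
      using s p x by (intro powr_mono2 lp_sum_le) (auto simp: p_def sum_nonneg)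
    finally show ?thesis by (simp add: powr_powr p)
  qed
  then have "scaled_hadamard_op s x \<in> lp s \<and> lp_norm s (scaled_hadamard_op s x) \<le> lp_norm p x"
    using s by (intro lp_leI) (auto simp: lp_norm_nonneg)
  then show "scaled_hadamard_op s x \<in> lp s"
    "lp_norm s (scaled_hadamard_op s x) \<le> lp_norm (s / (s - 1)) x" by (auto simp: p_def)
qed

lemma scaled_hadamard_op_add:
  "scaled_hadamard_op s (x + y) = scaled_hadamard_op s x + scaled_hadamard_op s y"
  by (rule ext) (simp add: scaled_hadamard_op_def Let_def algebra_simps sum.distrib)

lemma scaled_hadamard_op_scale:
  fixes x :: "nat \<Rightarrow> 'a::real_normed_field"
  shows "scaled_hadamard_op s (seq_scale c x) = seq_scale c (scaled_hadamard_op s x)"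
  by (rule ext) (simp add: scaled_hadamard_op_def seq_scale_def Let_def sum_distrib_left)

lemma scaled_hadamard_op_lp:
  fixes x :: "nat \<Rightarrow> 'a::{real_normed_field, euclidean_space}"
  assumes s: "2 \<le> s" and a: "1 \<le> a" "a \<le> s / (s - 1)" and b: "s \<le> b" and x: "x \<in> lp a"
  shows "scaled_hadamard_op s x \<in> lp b" "lp_norm b (scaled_hadamard_op s x) \<le> lp_norm a x"
proof -
  have x': "x \<in> lp (s / (s - 1))" "lp_norm (s / (s - 1)) x \<le> lp_norm a x"
    using lp_mono[of a "s / (s - 1)" x] a x by auto
  note C = scaled_hadamard_op_contraction[OF s x'(1)]
  have "scaled_hadamard_op s x \<in> lp b"
    "lp_norm b (scaled_hadamard_op s x) \<le> lp_norm s (scaled_hadamard_op s x)"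
    using lp_mono[OF _ b C(1)] s by auto
  then show "scaled_hadamard_op s x \<in> lp b" "lp_norm b (scaled_hadamard_op s x) \<le> lp_norm a x"
    using C x' by auto
qed

lemma bounded_op_scaled_hadamard:
  assumes "2 \<le> s" "1 \<le> a" "a \<le> s / (s - 1)" "s \<le> b"
  shows "bounded_op a b
    (scaled_hadamard_op s :: (nat \<Rightarrow> 'a::{real_normed_field, euclidean_space}) \<Rightarrow> nat \<Rightarrow> 'a)"
  unfolding bounded_op_def
  using scaled_hadamard_op_lp[OF assms]
  by (auto simp: scaled_hadamard_op_add scaled_hadamard_op_scale simp del: plus_fun_apply plus_fun_def
      intro!: exI[of _ 1])

definition hadamard_row :: "nat \<Rightarrow> nat \<Rightarrow> nat \<Rightarrow> 'a::real_normed_field" where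
  "hadamard_row n i k =
    (if k \<in> {block_start n..<block_start n + 2 ^ n}
     then of_real (hadamard n i (k - block_start n)) else 0)"

lemma lp_hadamard_row:
  assumes "0 < p"
  shows "(hadamard_row n i :: nat \<Rightarrow> 'a::real_normed_field) \<in> lp p"
    "lp_norm p (hadamard_row n i :: nat \<Rightarrow> 'a) = real (2 ^ n) powr (1 / p)"
proof -
  note * = lp_finite_support[OF assms, of "{block_start n..<block_start n + 2 ^ n}"
      "hadamard_row n i :: nat \<Rightarrow> 'a"]
  show "(hadamard_row n i :: nat \<Rightarrow> 'a) \<in> lp p" by (rule *) (auto simp: hadamard_row_def)
  show "lp_norm p (hadamard_row n i :: nat \<Rightarrow> 'a) = real (2 ^ n) powr (1 / p)"
    by (subst *) (auto simp: hadamard_row_def abs_hadamard)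
qed

lemma scaled_hadamard_op_row:
  assumes "1 \<le> n" "i < 2 ^ n"
  shows "scaled_hadamard_op s (hadamard_row n i) (block_start n + i) =
    (of_real (real (2 ^ n) powr (1 - 1 / s)) :: 'a::real_normed_field)"
proof -
  have "(\<Sum>j<2 ^ n. hadamard n i j *\<^sub>R (hadamard_row n i (block_start n + j) :: 'a)) =
      (\<Sum>j<(2::nat) ^ n. 1)"
    by (intro sum.cong refl)
      (simp add: hadamard_row_def scaleR_conv_of_real hadamard_mult_self flip: of_real_mult)
  also have "\<dots> = of_real (real (2 ^ n))" by simp
  finally have "scaled_hadamard_op s (hadamard_row n i) (block_start n + i) =
      (of_real (real (2 ^ n) powr (- 1 / s) * real (2 ^ n)) :: 'a)"
    using assms by (simp add: scaled_hadamard_op_block scaleR_conv_of_real)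
  also have "real (2 ^ n) powr (- 1 / s) * real (2 ^ n) = real (2 ^ n) powr (1 - 1 / s)"
    using powr_add[of "real (2 ^ n)" 1 "- 1 / s"] by simp
  finally show ?thesis .
qed

lemma scaled_hadamard_op_unit_seq:
  assumes "1 \<le> n" "i < 2 ^ n" "j < 2 ^ n"
  shows "scaled_hadamard_op s (unit_seq (block_start n + j)) (block_start n + i) =
    (of_real (real (2 ^ n) powr (- 1 / s) * hadamard n i j) :: 'a::real_normed_field)"
proof -
  have "(\<Sum>l<2 ^ n. hadamard n i l *\<^sub>R (unit_seq (block_start n + j) (block_start n + l) :: 'a)) =
      (\<Sum>l<2 ^ n. if l = j then of_real (hadamard n i j) else 0)"
    by (intro sum.cong refl) (auto simp: unit_seq_def scaleR_conv_of_real)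
  also have "\<dots> = of_real (hadamard n i j)" using assms by simp
  finally show ?thesis using assms by (simp add: scaled_hadamard_op_block scaleR_conv_of_real)
qed

section \<open>Norm and failure of compactness\<close>

lemma scaled_hadamard_op_support:
  assumes "\<And>k. block_of k \<noteq> n \<Longrightarrow> x k = 0" "block_of k \<noteq> n"
  shows "scaled_hadamard_op s x k = 0"
proof -
  have "x (block_start (block_of k) + j) = 0" if "j < 2 ^ block_of k" for j
    using assms block_of_block_start[OF block_of_ge_1 that] by metis
  then show ?thesis by (simp add: scaled_hadamard_op_def Let_def)
qed

lemma lp_block_sum_le:
  assumes "0 < p" "x \<in> lp p"
  shows "(\<Sum>i<m. norm (x (a + i)) powr p) \<le> lp_norm p x powr p"
  using lp_sum_le[OF assms, of "(+) a ` {..<m}"] by (simp add: sum.reindex)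

text \<open>
  If \<open>s = q\<close>, the image of a unit vector has \<open>N\<close> coordinates of modulus \<open>N powr (- 1 / q)\<close>. If
  \<open>s\<close> is conjugate to \<open>p\<close>, the image of a normalised row of the matrix has a coordinate of modulus 1.
\<close>

lemma block_norming_vector:
  assumes s: "2 \<le> s" and p: "1 \<le> p" "p \<le> s / (s - 1)" and q: "s \<le> q"
    and sharp: "s = q \<or> p = s / (s - 1)" and n: "1 \<le> n"
  obtains x :: "nat \<Rightarrow> 'a::{real_normed_field, euclidean_space}"
  where "x \<in> lp p" "lp_norm p x = 1" "1 \<le> lp_norm q (scaled_hadamard_op s x)"
    "\<And>k. block_of k \<noteq> n \<Longrightarrow> scaled_hadamard_op s x k = 0"
proof (cases "s = q")
  case True
  define x :: "nat \<Rightarrow> 'a" where "x = unit_seq (block_start n + 0)"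
  have x: "x \<in> lp p" "lp_norm p x = 1" unfolding x_def by (rule lp_unit_seq; use p in simp)+
  have V: "scaled_hadamard_op s x \<in> lp q" using scaled_hadamard_op_lp[OF s p q] x by auto
  have "(\<Sum>i<2 ^ n. norm (scaled_hadamard_op s x (block_start n + i)) powr q) =
      (\<Sum>i<(2::nat) ^ n. real (2 ^ n) powr - 1)"
    unfolding x_def using n True s
    by (intro sum.cong refl, subst scaled_hadamard_op_unit_seq)
      (auto simp: norm_mult abs_hadamard powr_powr abs_mult)
  also have "\<dots> = 1" by (simp add: powr_minus)
  finally have "1 powr q \<le> lp_norm q (scaled_hadamard_op s x) powr q"
    using lp_block_sum_le[OF _ V, of "block_start n" "2 ^ n"] s q by simp
  then have "1 \<le> lp_norm q (scaled_hadamard_op s x)"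
    by (rule powr_le_powr_imp_le) (use s q in \<open>auto simp: lp_norm_nonneg\<close>)
  moreover have "x k = 0" if "block_of k \<noteq> n" for k
    using that block_of_block_start[OF n, of 0] by (auto simp: x_def unit_seq_def)
  ultimately show ?thesis using that x scaled_hadamard_op_support[of n x] by blast
next
  case False
  then have p_eq: "p = s / (s - 1)" using sharp by simp
  define c :: 'a where "c = of_real (real (2 ^ n) powr - (1 / p))"
  define x :: "nat \<Rightarrow> 'a" where "x = seq_scale c (hadamard_row n 0)"
  note row = lp_hadamard_row[of p n 0, where 'a = 'a]
  have c: "norm c * real (2 ^ n) powr (1 / p) = 1" by (simp add: c_def powr_minus norm_inverse)
  have x: "x \<in> lp p" "lp_norm p x = 1"
    unfolding x_def using lp_scale[of p "hadamard_row n 0" c] row p c by auto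
  have V: "scaled_hadamard_op s x \<in> lp q" using scaled_hadamard_op_lp[OF s p q] x by auto
  have "1 - 1 / s = 1 / p" using s by (simp add: p_eq field_simps)
  then have "norm (scaled_hadamard_op s x (block_start n + 0)) = norm c * real (2 ^ n) powr (1 / p)"
    unfolding x_def scaled_hadamard_op_scale using n scaled_hadamard_op_row[of n 0 s, where 'a = 'a]
    by (simp add: seq_scale_def norm_mult)
  then have "1 \<le> lp_norm q (scaled_hadamard_op s x)"
    using norm_le_lp_norm[OF _ V, of "block_start n + 0"] s q c by simp
  moreover have "x k = 0" if "block_of k \<noteq> n" for k
  proof -
    have "k \<notin> {block_start n..<block_start n + 2 ^ n}"
    proof
      assume "k \<in> {block_start n..<block_start n + 2 ^ n}"
      then have "block_of (block_start n + (k - block_start n)) = n"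
        using n by (intro block_of_block_start) auto
      then show False using that \<open>k \<in> _\<close> by simp
    qed
    then show ?thesis
      by (simp add: x_def seq_scale_def hadamard_row_def del: atLeastLessThan_iff)
  qed
  ultimately show ?thesis using that x scaled_hadamard_op_support[of n x] by blast
qed

lemma op_norm_scaled_hadamard:
  assumes s: "2 \<le> s" and p: "1 \<le> p" "p \<le> s / (s - 1)" and q: "s \<le> q"
    and sharp: "s = q \<or> p = s / (s - 1)"
  shows "op_norm p q
    (scaled_hadamard_op s :: (nat \<Rightarrow> 'a::{real_normed_field, euclidean_space}) \<Rightarrow> nat \<Rightarrow> 'a) = 1"
proof (rule antisym)
  note V = scaled_hadamard_op_lp[OF s p q, where 'a = 'a]
  show "op_norm p q (scaled_hadamard_op s :: (nat \<Rightarrow> 'a) \<Rightarrow> nat \<Rightarrow> 'a) \<le> 1"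
    unfolding op_norm_def
  proof (rule cSUP_least)
    show "{x \<in> lp p. lp_norm p (x :: nat \<Rightarrow> 'a) \<le> 1} \<noteq> {}"
      using lp_unit_seq[of p 0, where 'a = 'a] p by auto
  qed (use V in force)
  obtain x :: "nat \<Rightarrow> 'a" where x: "x \<in> lp p" "lp_norm p x = 1" "1 \<le> lp_norm q (scaled_hadamard_op s x)"
    by (rule block_norming_vector[OF assms order_refl])
  have "lp_norm q (scaled_hadamard_op s x) \<le>
      op_norm p q (scaled_hadamard_op s :: (nat \<Rightarrow> 'a) \<Rightarrow> nat \<Rightarrow> 'a)"
    by (rule lp_norm_le_op_norm[where C = 1]) (use V x in auto)
  then show "1 \<le> op_norm p q (scaled_hadamard_op s :: (nat \<Rightarrow> 'a) \<Rightarrow> nat \<Rightarrow> 'a)"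
    using x by linarith
qed

lemma lp_norm_mono_pointwise:
  assumes "0 < p" "y \<in> lp p" "\<And>k. norm (x k) \<le> norm (y k)"
  shows "lp_norm p x \<le> lp_norm p y"
proof -
  have "(\<Sum>k<K. norm (x k) powr p) \<le> lp_norm p y powr p" for K
  proof -
    have "(\<Sum>k<K. norm (x k) powr p) \<le> (\<Sum>k<K. norm (y k) powr p)"
      using assms by (intro sum_mono powr_mono2) auto
    also have "\<dots> \<le> lp_norm p y powr p" using assms by (intro lp_sum_le) auto
    finally show ?thesis .
  qed
  then show ?thesis using lp_leI[of p "lp_norm p y" x] assms by (simp add: lp_norm_nonneg)
qed

lemma not_compact_op_scaled_hadamard:
  assumes s: "2 \<le> s" and p: "1 \<le> p" "p \<le> s / (s - 1)" and q: "s \<le> q"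
    and sharp: "s = q \<or> p = s / (s - 1)"
  shows "\<not> compact_op p q
    (scaled_hadamard_op s :: (nat \<Rightarrow> 'a::{real_normed_field, euclidean_space}) \<Rightarrow> nat \<Rightarrow> 'a)"
proof
  let ?V = "scaled_hadamard_op s :: (nat \<Rightarrow> 'a) \<Rightarrow> nat \<Rightarrow> 'a"
  define S where "S = ?V ` {x \<in> lp p. lp_norm p x \<le> 1}"
  assume "compact_op p q ?V"
  then have comp: "compactin (lp_topology q) (lp_topology q closure_of S)"
    unfolding compact_op_def S_def by simp
  have q1: "1 \<le> q" using s q by simp
  interpret M: Metric_space "lp q :: (nat \<Rightarrow> 'a) set" "\<lambda>x y. lp_norm q (x - y)"
    by (rule Metric_space_lp[OF q1])
  have V: "?V x \<in> lp q" if "x \<in> lp p" for x using scaled_hadamard_op_lp[OF s p q] that by auto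
  have tb: "M.mtotally_bounded (M.mtopology closure_of S)"
    using comp unfolding lp_topology_def by (rule M.compactin_imp_mtotally_bounded)
  have sub: "S \<subseteq> M.mtopology closure_of S"
    by (rule closure_of_subset) (use V in \<open>auto simp: S_def\<close>)
  have "\<exists>x :: nat \<Rightarrow> 'a. x \<in> lp p \<and> lp_norm p x = 1 \<and> 1 \<le> lp_norm q (?V x) \<and>
      (\<forall>k. block_of k \<noteq> Suc n \<longrightarrow> ?V x k = 0)" for n
    by (rule block_norming_vector[OF assms, of "Suc n"]) (simp, blast)
  then obtain x :: "nat \<Rightarrow> nat \<Rightarrow> 'a" where x: "\<And>n. x n \<in> lp p" "\<And>n. lp_norm p (x n) = 1"
    "\<And>n. 1 \<le> lp_norm q (?V (x n))" "\<And>n k. block_of k \<noteq> Suc n \<Longrightarrow> ?V (x n) k = 0"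
    by metis
  have sep: "1 \<le> lp_norm q (?V (x m) - ?V (x n))" if "m \<noteq> n" for m n
  proof -
    have "lp_norm q (?V (x m)) \<le> lp_norm q (?V (x m) - ?V (x n))"
    proof (rule lp_norm_mono_pointwise)
      show "?V (x m) - ?V (x n) \<in> lp q" by (intro lp_diff(1)[OF q1] V x)
      show "norm (?V (x m) k) \<le> norm ((?V (x m) - ?V (x n)) k)" for k
        using x(4)[of k n] x(4)[of k m] that by (cases "block_of k = Suc n") auto
    qed (use q1 in simp)
    then show ?thesis using x(3)[of m] by linarith
  qed
  have "range (\<lambda>n. ?V (x n)) \<subseteq> M.mtopology closure_of S"
    using sub x by (force simp: S_def)
  then obtain r where r: "strict_mono r" "M.MCauchy ((\<lambda>n. ?V (x n)) \<circ> r)"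
    using tb unfolding M.mtotally_bounded_sequentially by blast
  then obtain N where "\<And>n m. N \<le> n \<Longrightarrow> N \<le> m \<Longrightarrow> lp_norm q (?V (x (r n)) - ?V (x (r m))) < 1"
    unfolding M.MCauchy_def by (metis comp_apply zero_less_one)
  from this[of N "Suc N"] sep[of "r N" "r (Suc N)"] r(1) show False
    using strict_mono_eq[of r N "Suc N"] by simp
qed

section \<open>Flat vectors in finite-dimensional subspaces\<close>

interpretation seq_pair: vector_space_pair
  "seq_scale :: 'a::field \<Rightarrow> (nat \<Rightarrow> 'a) \<Rightarrow> nat \<Rightarrow> 'a"
  "seq_scale :: 'a::field \<Rightarrow> (nat \<Rightarrow> 'a) \<Rightarrow> nat \<Rightarrow> 'a" ..

lemma exists_nonzero_vanishing:
  fixes T :: "(nat \<Rightarrow> 'a::field) \<Rightarrow> nat \<Rightarrow> 'a"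
  assumes T: "\<And>x y. T (x + y) = T x + T y" "\<And>c x. T (seq_scale c x) = seq_scale c (T x)"
    and B: "seq.independent B" and A: "finite A" "card A < card B"
  obtains y where "y \<in> seq.span B" "y \<noteq> 0" "\<And>k. k \<in> A \<Longrightarrow> T y k = 0"
proof (rule ccontr)
  assume none: "\<not> thesis"
  \<comment> \<open>Otherwise restriction to \<open>A\<close> would embed the span of \<open>B\<close> into a space of dimension \<open>card A\<close>.\<close>
  define R where "R y = (\<lambda>k. if k \<in> A then T y k else 0)" for y
  have lin: "Vector_Spaces.linear seq_scale seq_scale R"
  proof unfold_locales
    show "R (x + y) = R x + R y" for x y by (rule ext) (simp add: R_def T(1))
    show "R (seq_scale c x) = seq_scale c (R x)" for c x
      unfolding R_def T(2) by (rule ext) (simp add: seq_scale_def)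
  qed
  have "inj_on R (seq.span B)"
    unfolding seq_pair.linear_inj_on_iff_eq_0[OF lin seq.subspace_span]
  proof (intro ballI impI, rule ccontr)
    fix y assume y: "y \<in> seq.span B" "R y = 0" "y \<noteq> 0"
    then have "T y k = 0" if "k \<in> A" for k using that by (auto simp: R_def fun_eq_iff split: if_splits)
    then show False using none that y by blast
  qed
  then have "seq.independent (R ` B)" "card (R ` B) = card B"
    using seq_pair.linear_independent_injective_image[OF lin B]
      card_image[OF inj_on_subset[OF _ seq.span_superset]] by auto
  moreover have "R ` B \<subseteq> seq.span (unit_seq ` A)"
  proof
    fix z assume "z \<in> R ` B"
    then have "\<And>k. k \<notin> A \<Longrightarrow> z k = 0" by (auto simp: R_def)
    then have "z = (\<Sum>j\<in>A. seq_scale (z j) (unit_seq j))"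
      using A by (intro finite_support_unit_seq_expansion)
    also have "\<dots> \<in> seq.span (unit_seq ` A)"
      by (intro seq.span_sum seq.span_scale seq.span_base) auto
    finally show "z \<in> seq.span (unit_seq ` A)" .
  qed
  ultimately have "card B \<le> card (unit_seq ` A :: (nat \<Rightarrow> 'a) set)"
    using seq.independent_span_bound[of "unit_seq ` A" "R ` B"] A by auto
  also have "\<dots> \<le> card A" using A by (intro card_image_le)
  finally show False using A by simp
qed

text \<open>
  One coordinate is gained at a time: given \<open>x\<close> of sup norm 1 with fewer than \<open>n\<close> coordinates of
  modulus 1, some \<open>y \<noteq> 0\<close> in the space vanishes on these, and \<open>x + t y\<close> for the largest \<open>t\<close>
  keeping the sup norm at most 1 has another one, because the sequences tend to 0.
\<close>

lemma exists_largest_multiple: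
  fixes x y :: "nat \<Rightarrow> 'a::real_normed_field"
  assumes x: "x \<longlonglongrightarrow> 0" "\<And>k. norm (x k) \<le> 1" and y: "y \<longlonglongrightarrow> 0" "y \<noteq> 0"
    and A: "\<And>k. k \<in> A \<Longrightarrow> y k = 0"
  obtains t l where "\<And>k. norm (x k + of_real t * y k) \<le> 1" "l \<notin> A" "norm (x l + of_real t * y l) = 1"
proof -
  define J where "J = {t. 0 \<le> t \<and> (\<forall>k. norm (x k + of_real t * y k) \<le> 1)}"
  obtain k0 where k0: "y k0 \<noteq> 0" using y(2) by (auto simp: fun_eq_iff)
  have "t \<le> 2 / norm (y k0)" if "t \<in> J" for t
  proof -
    have "t * norm (y k0) = norm ((x k0 + of_real t * y k0) - x k0)"
      using that by (simp add: J_def norm_mult)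
    also have "\<dots> \<le> norm (x k0 + of_real t * y k0) + norm (x k0)" by (rule norm_triangle_ineq4)
    also have "\<dots> \<le> 1 + 1" using that x(2)[of k0] by (intro add_mono) (auto simp: J_def)
    finally show ?thesis using k0 by (simp add: field_simps)
  qed
  then have bdd: "bdd_above J" by (auto simp: bdd_above_def)
  have ne: "0 \<in> J" using x by (simp add: J_def)
  have "J = {0..} \<inter> (\<Inter>k. {t. norm (x k + of_real t * y k) \<le> 1})" by (auto simp: J_def)
  also have "closed \<dots>"
    by (intro closed_Int closed_INT closed_atLeast ballI closed_Collect_le continuous_intros)
  finally have closed: "closed J" .
  define t where "t = Sup J"
  have t: "t \<in> J" unfolding t_def using closed_contains_Sup[OF _ bdd closed] ne by blast
  define z where "z k = x k + of_real t * y k" for k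
  have z1: "norm (z k) \<le> 1" for k using t by (simp add: J_def z_def)
  have "\<exists>l. l \<notin> A \<and> norm (z l) = 1"
  proof (rule ccontr)
    assume no: "\<not> ?thesis"
    have "z \<longlonglongrightarrow> 0 + of_real t * 0" unfolding z_def by (intro tendsto_intros x y)
    then have "(\<lambda>k. norm (z k)) \<longlonglongrightarrow> 0" using tendsto_norm by fastforce
    then have "eventually (\<lambda>k. norm (z k) < 1 / 2) sequentially" by (rule order_tendstoD) simp
    then obtain K where K: "\<And>k. K \<le> k \<Longrightarrow> norm (z k) < 1 / 2"
      unfolding eventually_sequentially by blast
    define m where "m = Max (insert (1 / 2) ((\<lambda>k. norm (z k)) ` ({..<K} - A)))"
    have m: "m < 1" unfolding m_def using no z1 by (subst Max_less_iff) (auto simp: less_le)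
    have zm: "norm (z k) \<le> m" if "k \<notin> A" for k
    proof (cases "k < K")
      case True
      then show ?thesis unfolding m_def using that by (intro Max_ge) auto
    next
      case False
      have "1 / 2 \<le> m" unfolding m_def by (intro Max_ge) auto
      then show ?thesis using K[of k] False by simp
    qed
    obtain Y where Y: "0 < Y" "\<And>k. norm (y k) \<le> Y"
      using convergent_imp_Bseq[of y] y(1) unfolding Bseq_def convergent_def by blast
    define d where "d = (1 - m) / Y"
    have d: "0 < d" using m Y by (simp add: d_def)
    have "norm (x k + of_real (t + d) * y k) \<le> 1" for k
    proof (cases "k \<in> A")
      case True
      then show ?thesis using A x by simp
    next
      case False
      have "norm (x k + of_real (t + d) * y k) = norm (z k + of_real d * y k)"
        by (simp add: z_def algebra_simps)
      also have "\<dots> \<le> norm (z k) + d * norm (y k)"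
        using norm_triangle_ineq[of "z k" "of_real d * y k"] d by (simp add: norm_mult)
      also have "\<dots> \<le> m + d * Y" using d by (intro add_mono zm False mult_left_mono Y) auto
      also have "\<dots> = 1" using Y by (simp add: d_def)
      finally show ?thesis .
    qed
    then have "t + d \<in> J" using t d by (simp add: J_def)
    then have "t + d \<le> t" unfolding t_def by (intro cSup_upper bdd)
    then show False using d by simp
  qed
  then show ?thesis using that[of t] z1 unfolding z_def by blast
qed

lemma exists_flat_image:
  fixes T :: "(nat \<Rightarrow> 'a::real_normed_field) \<Rightarrow> nat \<Rightarrow> 'a"
  assumes T: "\<And>x y. T (x + y) = T x + T y" "\<And>c x. T (seq_scale c x) = seq_scale c (T x)"
    and E: "seq.subspace E" "seq.dim E = n" "1 \<le> n" and null: "\<And>x. x \<in> E \<Longrightarrow> T x \<longlonglongrightarrow> 0"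
  obtains x A M where "x \<in> E" "x \<noteq> 0" "finite A" "card A = n"
    "\<And>k. norm (T x k) \<le> M" "\<And>k. k \<in> A \<Longrightarrow> norm (T x k) = M"
proof (cases "\<exists>x\<in>E. x \<noteq> 0 \<and> T x = 0")
  case True
  then obtain x where "x \<in> E" "x \<noteq> 0" "T x = 0" by blast
  then show ?thesis using that[of x "{..<n}" 0] by simp
next
  case inj: False
  have T0: "T 0 = 0" using T(2)[of 0 0] by simp
  obtain B where B: "B \<subseteq> E" "seq.independent B" "card B = n"
    using seq.basis_exists[of E] E(2) by metis
  have step: "\<exists>x A. x \<in> E \<and> finite A \<and> card A = m \<and> (\<forall>k. norm (T x k) \<le> 1) \<and> (\<forall>k\<in>A. norm (T x k) = 1)"
    if "m \<le> n" for m
    using that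
  proof (induction m)
    case 0
    have "0 \<in> E \<and> finite {} \<and> card {} = (0::nat) \<and> (\<forall>k. norm (T 0 k) \<le> 1) \<and> (\<forall>k\<in>{}. norm (T 0 k) = 1)"
      unfolding T0 using seq.subspace_0[OF E(1)] by simp
    then show ?case by blast
  next
    case (Suc m)
    then obtain x A where x: "x \<in> E" "finite A" "card A = m" "\<And>k. norm (T x k) \<le> 1"
      "\<And>k. k \<in> A \<Longrightarrow> norm (T x k) = 1"
      by (metis Suc_leD)
    have "card A < card B" using x(3) B(3) Suc.prems by simp
    then obtain y where y: "y \<in> seq.span B" "y \<noteq> 0" "\<And>k. k \<in> A \<Longrightarrow> T y k = 0"
      using exists_nonzero_vanishing[OF T B(2) x(2)] by blast
    have yE: "y \<in> E" using seq.span_minimal[OF B(1) E(1)] y(1) by blast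
    then have Ty: "T y \<noteq> 0" using inj y(2) by blast
    obtain t l where t: "\<And>k. norm (T x k + of_real t * T y k) \<le> 1" "l \<notin> A"
      "norm (T x l + of_real t * T y l) = 1"
      by (rule exists_largest_multiple[OF null[OF x(1)] x(4) null[OF yE] Ty y(3)]) blast+
    define w where "w = x + seq_scale (of_real t) y"
    have w: "w \<in> E" "T w k = T x k + of_real t * T y k" for k
    proof -
      show "w \<in> E" unfolding w_def using E(1) x(1) yE by (intro seq.subspace_add seq.subspace_scale)
      show "T w k = T x k + of_real t * T y k" unfolding w_def T by (simp add: seq_scale_def)
    qed
    have "\<forall>k\<in>insert l A. norm (T w k) = 1" using w t x y by auto
    moreover have "card (insert l A) = Suc m" "finite (insert l A)" using x t by auto
    ultimately show ?case using w t(1) by (intro exI[of _ w] exI[of _ "insert l A"]) auto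
  qed
  obtain x A where x: "x \<in> E" "finite A" "card A = n" "\<And>k. norm (T x k) \<le> 1"
    "\<And>k. k \<in> A \<Longrightarrow> norm (T x k) = 1" using step[OF order_refl] by blast
  have "A \<noteq> {}" using x(3) E(3) by auto
  then obtain k where "k \<in> A" by blast
  then have "x \<noteq> 0" using x(5)[of k] T0 by auto
  then show ?thesis using that[of x A 1] x by blast
qed

text \<open>
  A sequence with \<open>n\<close> coordinates of maximal modulus \<open>M\<close> satisfies \<open>n * M powr a \<le> 1\<close> if its
  \<open>a\<close>-norm is at most 1, which makes its \<open>b\<close>-norm small when \<open>b > a\<close>.
\<close>

lemma flat_lp_norm_le:
  assumes "1 \<le> a" "a < b" "z \<in> lp a" "lp_norm a z \<le> 1" "finite A" "card A = n" "1 \<le> n"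
    and M: "\<And>k. norm (z k) \<le> M" "\<And>k. k \<in> A \<Longrightarrow> norm (z k) = M"
  shows "lp_norm b z \<le> real n powr - (1 / a - 1 / b)"
proof -
  have M0: "0 \<le> M" using M(1)[of 0] norm_ge_zero order_trans by blast
  have le1: "lp_norm a z powr a \<le> 1" using assms lp_norm_nonneg[of a z] by (intro powr_le1) auto
  have "real n * M powr a = (\<Sum>k\<in>A. norm (z k) powr a)" using assms by simp
  also have "\<dots> \<le> 1" using lp_sum_le[of a z A] assms le1 by simp
  finally have "M powr a \<le> 1 / real n" using assms by (simp add: field_simps)
  then have "(M powr a) powr ((b - a) / a) \<le> (1 / real n) powr ((b - a) / a)"
    using assms by (intro powr_mono2) auto
  then have Mn: "M powr (b - a) \<le> real n powr - ((b - a) / a)"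
    using assms by (simp add: powr_powr powr_minus_divide powr_divide)
  have "lp_norm b z powr b \<le> M powr (b - a) * lp_norm a z powr a"
    by (rule lp_norm_interpolation(2)) (use assms(1-3) M(1) in auto)
  also have "\<dots> \<le> M powr (b - a) * 1" using le1 by (intro mult_left_mono) auto
  also have "\<dots> \<le> (real n powr - (1 / a - 1 / b)) powr b"
  proof -
    have "- ((b - a) / a) = - (1 / a - 1 / b) * b" using assms(1,2) by (simp add: field_simps)
    then show ?thesis using Mn by (simp only: powr_powr mult_1_right)
  qed
  finally show ?thesis by (rule powr_le_powr_imp_le) (use assms(1,2) in auto)
qed

text \<open>
  Whichever of the inequalities \<open>p < s'\<close> and \<open>s < q\<close> is strict, the operator has the formal inclusion
  between the two spaces as a factor, before or after it; flat vectors in the domain or in the image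
  show that the inclusion is finitely strictly singular.
\<close>

lemma finitely_strictly_singular_scaled_hadamard:
  assumes s: "2 \<le> s" and p: "1 \<le> p" "p \<le> s / (s - 1)" and q: "s \<le> q"
    and strict: "p < s / (s - 1) \<or> s < q"
  shows "finitely_strictly_singular p q
    (scaled_hadamard_op s :: (nat \<Rightarrow> 'a::{real_normed_field, euclidean_space}) \<Rightarrow> nat \<Rightarrow> 'a)"
proof -
  let ?V = "scaled_hadamard_op s :: (nat \<Rightarrow> 'a) \<Rightarrow> nat \<Rightarrow> 'a"
  obtain T :: "(nat \<Rightarrow> 'a) \<Rightarrow> nat \<Rightarrow> 'a" and a b where
    T: "\<And>x y. T (x + y) = T x + T y" "\<And>c x. T (seq_scale c x) = seq_scale c (T x)"
    and ab: "1 \<le> a" "a < b"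
    and Ta: "\<And>x. x \<in> lp p \<Longrightarrow> T x \<in> lp a \<and> lp_norm a (T x) \<le> lp_norm p x"
    and Tb: "\<And>x. x \<in> lp p \<Longrightarrow> lp_norm q (?V x) \<le> lp_norm b (T x)"
  proof (cases "p < s / (s - 1)")
    case True
    have "lp_norm q (?V x) \<le> lp_norm (s / (s - 1)) x" if "x \<in> lp p" for x
      using scaled_hadamard_op_lp(2)[OF s _ order_refl q, of x] lp_mono(1)[of p "s / (s - 1)" x]
        that p s by (simp add: field_simps)
    then show ?thesis using that[of "\<lambda>x. x" p "s / (s - 1)"] True p by blast
  next
    case False
    then have "s < q" using strict by simp
    moreover have "1 \<le> s" using s by simp
    ultimately show ?thesis
      using that[of ?V s q, OF scaled_hadamard_op_add scaled_hadamard_op_scale]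
        scaled_hadamard_op_lp[OF s p order_refl, where 'a = 'a] by blast
  qed
  define d where "d = 1 / a - 1 / b"
  have d: "0 < d" using ab by (simp add: d_def field_simps)
  show ?thesis
    unfolding finitely_strictly_singular_def
  proof (intro conjI allI impI)
    show "bounded_op p q ?V" by (rule bounded_op_scaled_hadamard[OF s p q])
    fix \<epsilon> :: real assume e: "0 < \<epsilon>"
    have "((\<lambda>n. real n powr - d) \<longlongrightarrow> 0) sequentially"
      using d by (intro tendsto_neg_powr filterlim_real_sequentially) auto
    then have "eventually (\<lambda>n. real n powr - d < \<epsilon>) sequentially" using e by (rule order_tendstoD)
    then obtain n where n: "1 \<le> n" "real n powr - d < \<epsilon>"
      unfolding eventually_sequentially by (metis max.cobounded1 max.cobounded2)
    show "\<exists>n\<ge>1. \<forall>E. E \<subseteq> lp p \<and> seq.subspace E \<and> seq.dim E = n \<longrightarrow>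
        (INF x\<in>{x \<in> E. lp_norm p x = 1}. lp_norm q (?V x)) < \<epsilon>"
    proof (intro exI[of _ n] conjI allI impI)
      fix E :: "(nat \<Rightarrow> 'a) set"
      assume E: "E \<subseteq> lp p \<and> seq.subspace E \<and> seq.dim E = n"
      have null: "T x \<longlonglongrightarrow> 0" if "x \<in> E" for x
        using lp_tendsto_0[of a "T x"] Ta[of x] E that ab by auto
      obtain x A M where x: "x \<in> E" "x \<noteq> 0" "finite A" "card A = n"
        "\<And>k. norm (T x k) \<le> M" "\<And>k. k \<in> A \<Longrightarrow> norm (T x k) = M"
        using exists_flat_image[OF T _ _ n(1) null, of E] E by metis
      have xp: "x \<in> lp p" using x E by auto
      have "lp_norm p x \<noteq> 0" using lp_norm_eq_0_iff[OF _ xp] p x by auto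
      then have nx: "0 < lp_norm p x" using lp_norm_nonneg[of p x] by simp
      define c where "c = 1 / lp_norm p x"
      define y where "y = seq_scale (of_real c) x"
      have c: "norm (of_real c :: 'a) = c" "0 < c" using nx by (auto simp: c_def norm_divide)
      have y: "y \<in> E" "lp_norm p y = 1"
        using x E seq.subspace_scale lp_scale[OF _ xp] p nx c unfolding y_def by (auto simp: c_def)
      have Ty: "norm (T y k) = c * norm (T x k)" for k
        unfolding y_def T using c by (simp add: seq_scale_def norm_mult)
      have yp: "y \<in> lp p" using y E by auto
      have "lp_norm q (?V y) \<le> lp_norm b (T y)" using Tb yp by blast
      also have "\<dots> \<le> real n powr - d"
        unfolding d_def
        using flat_lp_norm_le[OF ab, of "T y" A n "c * M"] Ta[OF yp] y x n Ty c by simp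
      finally have "lp_norm q (?V y) < \<epsilon>" using n by simp
      moreover have "(INF x\<in>{x \<in> E. lp_norm p x = 1}. lp_norm q (?V x)) \<le> lp_norm q (?V y)"
        using y by (intro cINF_lower bdd_belowI2[where m = 0]) (auto simp: lp_norm_nonneg)
      ultimately show "(INF x\<in>{x \<in> E. lp_norm p x = 1}. lp_norm q (?V x)) < \<epsilon>" by simp
    qed (use n in simp)
  qed
qed

section \<open>Failure of approximate factorizations\<close>

text \<open>
  The exponent of \<open>N = 2 ^ n\<close> is larger on the right: \<open>(1 - 1 / s) * t\<close> exceeds 1 because \<open>t > s'\<close>, and
  it exceeds \<open>t - 1\<close> because \<open>t < s\<close>.
\<close>

lemma hadamard_growth:
  fixes s t M :: real
  assumes s: "2 \<le> s" and t: "s / (s - 1) < t" "t < s"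
  obtains n :: nat where "1 \<le> n"
    "real (2 ^ n) powr (1 + max 1 (t - 1)) * M powr t <
      real (2 ^ n) * (real (2 ^ n) powr (1 - 1 / s) / 2) powr t"
proof -
  define e where "e = (1 - 1 / s) * t - max 1 (t - 1)"
  have e: "0 < e"
  proof -
    have "t / s < 1" "0 < s" using s t by (auto simp: field_simps)
    moreover have "1 < (1 - 1 / s) * t" using s t by (simp add: field_simps)
    ultimately show ?thesis unfolding e_def by (simp add: max_def left_diff_distrib)
  qed
  have gt1: "1 < 2 powr e" using e powr_less_mono[of 0 e 2] by simp
  obtain m where "2 powr t * M powr t < (2 powr e) ^ m" using real_arch_pow[OF gt1] by blast
  also have "\<dots> \<le> (2 powr e) ^ Suc m" using gt1 by (intro power_increasing) auto
  finally obtain n where n: "1 \<le> n" "2 powr t * M powr t < (2 powr e) ^ n" by fastforce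
  define N where "N = real (2 ^ n)"
  have N: "0 < N" by (simp add: N_def)
  have "(2 powr e) ^ n = N powr e"
    by (simp add: N_def powr_powr mult.commute flip: powr_realpow)
  then have "M powr t < N powr e / 2 powr t" using n by (simp add: field_simps)
  then have "N powr (1 + max 1 (t - 1)) * M powr t < N powr (1 + max 1 (t - 1)) * (N powr e / 2 powr t)"
    using N by (intro mult_strict_left_mono) auto
  also have "\<dots> = N * (N powr (1 - 1 / s) / 2) powr t"
  proof -
    have "1 + max 1 (t - 1) + e = 1 + (1 - 1 / s) * t" by (simp add: e_def)
    then have "N powr (1 + max 1 (t - 1)) * N powr e = N * N powr ((1 - 1 / s) * t)"
      using N by (metis powr_add powr_one less_imp_le)
    then show ?thesis using N by (simp add: powr_divide powr_powr)
  qed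
  finally show ?thesis using that n unfolding N_def by blast
qed

text \<open>
  The rows of an operator on the \<open>r\<close>-summable sequences are functionals, so they are bounded in the
  conjugate norm; a finite section of a row is tested on the sequence attaining its norm.
\<close>

lemma bounded_op_row_bound:
  fixes A :: "(nat \<Rightarrow> 'a::real_normed_field) \<Rightarrow> nat \<Rightarrow> 'a"
  assumes A: "bounded_op r q A" and C: "0 \<le> C" "\<And>x. x \<in> lp r \<Longrightarrow> lp_norm q (A x) \<le> C * lp_norm r x"
    and r: "1 < r" and q: "1 \<le> q"
  shows "(\<Sum>k<K. norm (A (unit_seq k) i) powr (r / (r - 1))) \<le> C powr (r / (r - 1))"
proof -
  define t where "t = r / (r - 1)"
  have t: "1 < t" "(t - 1) * r = t" "1 - 1 / r = 1 / t" "1 / r + 1 / t = 1"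
    using r by (auto simp: t_def field_simps)
  define a where "a k = A (unit_seq k) i" for k
  define S where "S = (\<Sum>k<K. norm (a k) powr t)"
  define x where "x k = (if k < K then of_real (norm (a k) powr t) * inverse (a k) else 0)" for k
  have S0: "0 \<le> S" unfolding S_def by (simp add: sum_nonneg)
  have xa: "x k * a k = of_real (norm (a k) powr t)" if "k < K" for k
    using that by (cases "a k = 0") (simp_all add: x_def)
  have nx: "norm (x k) powr r = norm (a k) powr t" if "k < K" for k
  proof (cases "a k = 0")
    case False
    then have "norm (x k) = norm (a k) powr (t - 1)"
      using that by (simp add: x_def norm_mult norm_inverse norm_divide powr_diff field_simps)
    then show ?thesis by (simp add: powr_powr t)
  qed (use that in \<open>simp add: x_def\<close>)
  have supp: "x k = 0" if "k \<notin> {..<K}" for k using that by (simp add: x_def)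
  note lpx = lp_finite_support[of r "{..<K}" x, OF _ finite_lessThan supp]
  have x: "x \<in> lp r" "lp_norm r x = S powr (1 / r)"
  proof -
    have "(\<Sum>k<K. norm (x k) powr r) = S" unfolding S_def by (intro sum.cong) (auto simp: nx)
    then show "x \<in> lp r" "lp_norm r x = S powr (1 / r)" using lpx r by auto
  qed
  have "A x i = (\<Sum>k<K. x k * a k)"
    unfolding a_def using r by (intro bounded_op_finite_support[OF A] supp) auto
  also have "\<dots> = of_real S" unfolding S_def by (simp add: xa)
  finally have "S = norm (A x i)" using S0 by simp
  also have "\<dots> \<le> lp_norm q (A x)"
    using A x q unfolding bounded_op_def by (intro norm_le_lp_norm) auto
  also have "\<dots> \<le> C * S powr (1 / r)" using C(2)[OF x(1)] x(2) by simp
  finally have S: "S \<le> C * S powr (1 / r)" .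
  have "S powr (1 / t) \<le> C"
  proof (cases "S = 0")
    case True
    then show ?thesis using C by simp
  next
    case False
    have "S powr (1 / r) * S powr (1 / t) = S" using S0 False t by (simp flip: powr_add)
    then have "S powr (1 / r) * S powr (1 / t) \<le> S powr (1 / r) * C" using S by (simp add: mult.commute)
    then show ?thesis using False S0 by simp
  qed
  then have "(S powr (1 / t)) powr t \<le> C powr t" using t by (intro powr_mono2) auto
  moreover have "(S powr (1 / t)) powr t = S" using t(1) S0 by (simp add: powr_powr)
  ultimately have "S \<le> C powr t" by simp
  then show ?thesis unfolding S_def a_def t_def .
qed

text \<open>
  If \<open>p = s'\<close>, the coordinate \<open>i\<close> of the image of row \<open>i\<close> has modulus \<open>N powr (1 / p)\<close> for the block
  operator. A product \<open>A B\<close> cannot keep up: the images under \<open>B\<close> of the unit vectors of a block are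
  bounded, hence their Hadamard transforms, the images of the rows, are small in the mean.
\<close>

lemma factored_row_coordinate_small:
  fixes A B :: "(nat \<Rightarrow> 'a::{real_normed_field, euclidean_space}) \<Rightarrow> nat \<Rightarrow> 'a"
  assumes s: "2 \<le> s" and r: "s / (s - 1) < r" "r < s" and p: "1 \<le> p" and q: "1 \<le> q"
    and B: "bounded_op p r B" and A: "bounded_op r q A"
  obtains n i where "1 \<le> n" "i < 2 ^ n"
    "norm (A (B (hadamard_row n i)) (block_start n + i)) < real (2 ^ n) powr (1 - 1 / s) / 2"
proof -
  have r1: "1 < r"
  proof -
    have "1 < s / (s - 1)" using s by simp
    then show ?thesis using r by linarith
  qed
  obtain C where C: "0 \<le> C" "\<And>x. x \<in> lp r \<Longrightarrow> lp_norm q (A x) \<le> C * lp_norm r x"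
    using bounded_op_bound[OF A] by blast
  obtain D where D: "0 \<le> D" "\<And>x. x \<in> lp p \<Longrightarrow> lp_norm r (B x) \<le> D * lp_norm p x"
    using bounded_op_bound[OF B] by blast
  obtain n where n: "1 \<le> n" "real (2 ^ n) powr (1 + max 1 (r - 1)) * (C * D) powr r <
      real (2 ^ n) * (real (2 ^ n) powr (1 - 1 / s) / 2) powr r"
    using hadamard_growth[OF s r] by blast
  define b where "b j = B (unit_seq (block_start n + j))" for j
  have Bx: "B x \<in> lp r" if "x \<in> lp p" for x using B that unfolding bounded_op_def by blast
  have b: "(\<Sum>k<K. norm (b j k) powr r) \<le> D powr r" for j K
  proof -
    have u: "(unit_seq (block_start n + j) :: nat \<Rightarrow> 'a) \<in> lp p"
      "lp_norm p (unit_seq (block_start n + j) :: nat \<Rightarrow> 'a) = 1"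
      by (rule lp_unit_seq; use p in simp)+
    have "(\<Sum>k<K. norm (b j k) powr r) \<le> lp_norm r (b j) powr r"
      unfolding b_def using Bx[OF u(1)] r1 by (intro lp_sum_le) auto
    also have "\<dots> \<le> D powr r"
      unfolding b_def using D(2)[OF u(1)] u(2) r1 by (intro powr_mono2) (auto simp: lp_norm_nonneg)
    finally show ?thesis .
  qed
  have row: "hadamard_row n i \<in> lp p" for i using p by (intro lp_hadamard_row) auto
  have Brow: "B (hadamard_row n i) k = (\<Sum>j<2 ^ n. hadamard n i j *\<^sub>R b j k)" for i k
  proof -
    have "B (hadamard_row n i) k =
        (\<Sum>j\<in>(+) (block_start n) ` {..<2 ^ n}. hadamard_row n i j * B (unit_seq j) k)"
    proof (rule bounded_op_finite_support[OF B p])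
      fix k assume "k \<notin> (+) (block_start n) ` {..<2 ^ n}"
      moreover have "k = block_start n + (k - block_start n)" if "block_start n \<le> k" using that by simp
      ultimately have "\<not> (block_start n \<le> k \<and> k < block_start n + 2 ^ n)"
        by (metis imageI lessThan_iff nat_add_left_cancel_less)
      then show "hadamard_row n i k = (0 :: 'a)"
        unfolding hadamard_row_def atLeastLessThan_iff by (rule if_not_P)
    qed simp
    then show ?thesis
      by (simp add: sum.reindex hadamard_row_def b_def scaleR_conv_of_real)
  qed
  have "(\<Sum>i<2 ^ n. lp_norm r (B (hadamard_row n i)) powr r) \<le>
      real (2 ^ n) powr (1 + max 1 (r - 1)) * D powr r"
  proof (rule LIMSEQ_le_const2)
    show "(\<lambda>K. \<Sum>i<2 ^ n. \<Sum>k<K. norm (B (hadamard_row n i) k) powr r) \<longlonglongrightarrow>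
        (\<Sum>i<2 ^ n. lp_norm r (B (hadamard_row n i)) powr r)"
    proof (intro tendsto_sum)
      fix i
      have "summable (\<lambda>k. norm (B (hadamard_row n i) k) powr r)" using Bx[OF row] by (simp add: lp_def)
      then show "(\<lambda>K. \<Sum>k<K. norm (B (hadamard_row n i) k) powr r) \<longlonglongrightarrow>
          lp_norm r (B (hadamard_row n i)) powr r"
        using lp_norm_powr[OF _ Bx[OF row]] r1 summable_LIMSEQ by force
    qed
    show "\<exists>K0. \<forall>K\<ge>K0. (\<Sum>i<2 ^ n. \<Sum>k<K. norm (B (hadamard_row n i) k) powr r) \<le>
        real (2 ^ n) powr (1 + max 1 (r - 1)) * D powr r"
      unfolding Brow using hadamard_transform_rows_bound[OF r1 D(1), where c = b, OF b] by blast
  qed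
  then have upper: "C powr r * (\<Sum>i<2 ^ n. lp_norm r (B (hadamard_row n i)) powr r) \<le>
      real (2 ^ n) powr (1 + max 1 (r - 1)) * (C * D) powr r"
    using mult_left_mono[of _ _ "C powr r"] C D by (fastforce simp: powr_mult mult_ac)
  have "\<exists>i<2 ^ n. norm (A (B (hadamard_row n i)) (block_start n + i)) < real (2 ^ n) powr (1 - 1 / s) / 2"
  proof (rule ccontr)
    assume no: "\<not> ?thesis"
    have "(real (2 ^ n) powr (1 - 1 / s) / 2) powr r \<le> C powr r * lp_norm r (B (hadamard_row n i)) powr r"
      if "i < 2 ^ n" for i
    proof -
      have "real (2 ^ n) powr (1 - 1 / s) / 2 \<le> norm (A (B (hadamard_row n i)) (block_start n + i))"
        using no that by force
      also have "\<dots> \<le> lp_norm q (A (B (hadamard_row n i)))"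
        using A Bx[OF row] q unfolding bounded_op_def by (intro norm_le_lp_norm) auto
      also have "\<dots> \<le> C * lp_norm r (B (hadamard_row n i))" by (rule C(2)[OF Bx[OF row]])
      finally have "(real (2 ^ n) powr (1 - 1 / s) / 2) powr r \<le> (C * lp_norm r (B (hadamard_row n i))) powr r"
        using r1 by (intro powr_mono2) auto
      then show ?thesis using C by (simp add: powr_mult lp_norm_nonneg)
    qed
    then have "(\<Sum>i<(2::nat) ^ n. (real (2 ^ n) powr (1 - 1 / s) / 2) powr r) \<le>
        C powr r * (\<Sum>i<2 ^ n. lp_norm r (B (hadamard_row n i)) powr r)"
      unfolding sum_distrib_left by (intro sum_mono) auto
    then show False using n(2) upper by simp
  qed
  then show ?thesis using that n(1) by blast
qed

text \<open>
  If \<open>s = q\<close>, the dual argument applies: the pairing of the image of a unit vector with the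
  corresponding row is \<open>N powr (1 - 1 / q)\<close> for the block operator, but small in the mean for a
  product \<open>A B\<close>, because the rows of \<open>A\<close> are bounded functionals and are transformed by the Hadamard
  matrix in the pairing.
\<close>

lemma factored_pairing_small:
  fixes A B :: "(nat \<Rightarrow> 'a::{real_normed_field, euclidean_space}) \<Rightarrow> nat \<Rightarrow> 'a"
  assumes s: "2 \<le> s" and r: "s / (s - 1) < r" "r < s" and p: "1 \<le> p" and q: "1 \<le> q"
    and B: "bounded_op p r B" and A: "bounded_op r q A"
  obtains n j where "1 \<le> n" "j < 2 ^ n"
    "norm (\<Sum>i<2 ^ n. hadamard n j i *\<^sub>R A (B (unit_seq (block_start n + j))) (block_start n + i)) <
      real (2 ^ n) powr (1 - 1 / s) / 2"
proof -
  define t where "t = r / (r - 1)"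
  have r1: "1 < r"
  proof -
    have "1 < s / (s - 1)" using s by simp
    then show ?thesis using r by linarith
  qed
  have t1: "1 < t" "1 / r + 1 / t = 1" using r1 by (auto simp: t_def field_simps)
  have t: "s / (s - 1) < t" "t < s" using r r1 s by (auto simp: t_def field_simps)
  obtain C where C: "0 \<le> C" "\<And>x. x \<in> lp r \<Longrightarrow> lp_norm q (A x) \<le> C * lp_norm r x"
    using bounded_op_bound[OF A] by blast
  obtain D where D: "0 \<le> D" "\<And>x. x \<in> lp p \<Longrightarrow> lp_norm r (B x) \<le> D * lp_norm p x"
    using bounded_op_bound[OF B] by blast
  obtain n where n: "1 \<le> n" "real (2 ^ n) powr (1 + max 1 (t - 1)) * (D * C) powr t <
      real (2 ^ n) * (real (2 ^ n) powr (1 - 1 / s) / 2) powr t"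
    using hadamard_growth[OF s t] by blast
  define b where "b j = B (unit_seq (block_start n + j))" for j
  define a where "a i k = A (unit_seq k) (block_start n + i)" for i k
  define H where "H j k = (\<Sum>i<2 ^ n. hadamard n j i *\<^sub>R a i k)" for j k
  define P where "P j = (\<Sum>i<2 ^ n. hadamard n j i *\<^sub>R A (b j) (block_start n + i))" for j
  have a: "(\<Sum>k<K. norm (a i k) powr t) \<le> C powr t" for i K
    unfolding a_def t_def by (rule bounded_op_row_bound[OF A C r1 q])
  have b: "b j \<in> lp r" "lp_norm r (b j) \<le> D" for j
  proof -
    have u: "(unit_seq (block_start n + j) :: nat \<Rightarrow> 'a) \<in> lp p"
      "lp_norm p (unit_seq (block_start n + j) :: nat \<Rightarrow> 'a) = 1"
      by (rule lp_unit_seq; use p in simp)+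
    show "b j \<in> lp r" using B u unfolding bounded_op_def b_def by blast
    show "lp_norm r (b j) \<le> D" unfolding b_def using D(2)[OF u(1)] u(2) by simp
  qed
  have lim: "(\<lambda>K. \<Sum>k<K. b j k * H j k) \<longlonglongrightarrow> P j" for j
  proof -
    have "(\<lambda>K. \<Sum>i<2 ^ n. hadamard n j i *\<^sub>R (\<Sum>k<K. b j k * a i k)) \<longlonglongrightarrow> P j"
      unfolding P_def a_def using r1 q b
      by (intro tendsto_sum tendsto_scaleR tendsto_const bounded_op_coordinate_truncate[OF A]) auto
    moreover have "(\<Sum>i<2 ^ n. hadamard n j i *\<^sub>R (\<Sum>k<K. b j k * a i k)) = (\<Sum>k<K. b j k * H j k)" for K
      unfolding H_def scaleR_sum_right sum_distrib_left
      by (subst sum.swap) (simp add: mult_scaleR_right)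
    ultimately show ?thesis by simp
  qed
  have section_bound: "norm (\<Sum>k<K. b j k * H j k) powr t \<le> D powr t * (\<Sum>k<K. norm (H j k) powr t)" for j K
  proof -
    have "norm (\<Sum>k<K. b j k * H j k) \<le> (\<Sum>k<K. norm (b j k) * norm (H j k))"
      by (rule order_trans[OF norm_sum]) (simp add: norm_mult)
    also have "\<dots> \<le> (\<Sum>k<K. norm (b j k) powr r) powr (1 / r) * (\<Sum>k<K. norm (H j k) powr t) powr (1 / t)"
      using r1 t1 by (intro Holder_inequality_sum) auto
    also have "\<dots> \<le> D * (\<Sum>k<K. norm (H j k) powr t) powr (1 / t)"
    proof (intro mult_right_mono)
      have "(\<Sum>k<K. norm (b j k) powr r) \<le> D powr r"
        using b[of j] D r1 lp_norm_le_iff[of r D "b j"] by auto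
      then have "(\<Sum>k<K. norm (b j k) powr r) powr (1 / r) \<le> (D powr r) powr (1 / r)"
        using r1 by (intro powr_mono2) (auto intro: sum_nonneg)
      then show "(\<Sum>k<K. norm (b j k) powr r) powr (1 / r) \<le> D" using r1 D by (simp add: powr_powr)
    qed simp
    finally have "norm (\<Sum>k<K. b j k * H j k) powr t \<le>
        (D * (\<Sum>k<K. norm (H j k) powr t) powr (1 / t)) powr t"
      using t1 by (intro powr_mono2) auto
    then show ?thesis using D t1 by (simp add: powr_mult powr_powr sum_nonneg)
  qed
  have "(\<Sum>j<2 ^ n. norm (P j) powr t) \<le> real (2 ^ n) powr (1 + max 1 (t - 1)) * (D * C) powr t"
  proof (rule LIMSEQ_le_const2)
    show "(\<lambda>K. \<Sum>j<2 ^ n. norm (\<Sum>k<K. b j k * H j k) powr t) \<longlonglongrightarrow> (\<Sum>j<2 ^ n. norm (P j) powr t)"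
      using t1 by (intro tendsto_sum tendsto_powr' tendsto_norm lim tendsto_const) auto
    have "(\<Sum>j<2 ^ n. norm (\<Sum>k<K. b j k * H j k) powr t) \<le>
        real (2 ^ n) powr (1 + max 1 (t - 1)) * (D * C) powr t" for K
    proof -
      have "(\<Sum>j<2 ^ n. norm (\<Sum>k<K. b j k * H j k) powr t) \<le>
          D powr t * (\<Sum>j<2 ^ n. \<Sum>k<K. norm (H j k) powr t)"
        unfolding sum_distrib_left[of "D powr t" "\<lambda>j. \<Sum>k<K. norm (H j k) powr t"]
        by (intro sum_mono section_bound)
      also have "\<dots> \<le> D powr t * (real (2 ^ n) powr (1 + max 1 (t - 1)) * C powr t)"
        unfolding H_def using hadamard_transform_rows_bound[OF t1(1) C(1) a]
        by (intro mult_left_mono) auto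
      finally show ?thesis using C D by (simp add: powr_mult mult_ac)
    qed
    then show "\<exists>K0. \<forall>K\<ge>K0. (\<Sum>j<2 ^ n. norm (\<Sum>k<K. b j k * H j k) powr t) \<le>
        real (2 ^ n) powr (1 + max 1 (t - 1)) * (D * C) powr t" by blast
  qed
  note upper = this
  have "\<exists>j<2 ^ n. norm (P j) < real (2 ^ n) powr (1 - 1 / s) / 2"
  proof (rule ccontr)
    assume no: "\<not> ?thesis"
    have "(\<Sum>j<(2::nat) ^ n. (real (2 ^ n) powr (1 - 1 / s) / 2) powr t) \<le> (\<Sum>j<2 ^ n. norm (P j) powr t)"
      using no t1 by (intro sum_mono powr_mono2) force+
    then show False using n(2) upper by simp
  qed
  then show ?thesis using that n(1) unfolding P_def b_def by blast
qed

text \<open>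
  The quantities bounded in the two preceding lemmas are both \<open>N powr (1 - 1 / s)\<close> for the operator
  itself. A perturbation of norm at most \<open>1 / 2\<close> changes the pairing by at most
  \<open>N powr (1 - 1 / q) / 2\<close> and the coordinate by at most \<open>N powr (1 / p) / 2\<close>; if \<open>s = q\<close>, respectively
  \<open>s' = p\<close>, this leaves at least half of the original value.
\<close>

lemma scaled_hadamard_not_in_factor_closure:
  assumes s: "2 \<le> s" and p: "1 \<le> p" "p \<le> s / (s - 1)" and q: "s \<le> q"
    and sharp: "s = q \<or> p = s / (s - 1)" and r: "s / (s - 1) < r" "r < s"
  shows "(scaled_hadamard_op s :: (nat \<Rightarrow> 'a::{real_normed_field, euclidean_space}) \<Rightarrow> nat \<Rightarrow> 'a)
    \<notin> factor_closure r p q"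
proof
  let ?V = "scaled_hadamard_op s :: (nat \<Rightarrow> 'a) \<Rightarrow> nat \<Rightarrow> 'a"
  assume "?V \<in> factor_closure r p q"
  then have V: "bounded_op p q ?V" and
    "\<forall>\<epsilon>>0. \<exists>S. factors_through r p q S \<and> op_norm p q (\<lambda>x. ?V x - S x) < \<epsilon>"
    unfolding factor_closure_def by auto
  from this(2)[rule_format, of "1 / 2"] obtain S A B where S: "bounded_op p q S" "op_norm p q (\<lambda>x. ?V x - S x) < 1 / 2"
    and B: "bounded_op p r B" and A: "bounded_op r q A" and SAB: "\<And>x. x \<in> lp p \<Longrightarrow> S x = A (B x)"
    unfolding factors_through_def by auto
  have q1: "1 \<le> q" using s q by simp
  have in_q: "?V x - S x \<in> lp q" if "x \<in> lp p" for x
    using V S(1) that unfolding bounded_op_def by (intro lp_diff(1)[OF q1]) auto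
  have close: "lp_norm q (?V x - S x) \<le> 1 / 2 * lp_norm p x" if "x \<in> lp p" for x
  proof -
    have "lp_norm q (?V x - S x) \<le> op_norm p q (\<lambda>x. ?V x - S x) * lp_norm p x"
      using lp_norm_diff_le_op_norm[OF V S(1) q1 _ that] p by simp
    also have "\<dots> \<le> 1 / 2 * lp_norm p x"
      using S(2) by (intro mult_right_mono lp_norm_nonneg) auto
    finally show ?thesis .
  qed
  show False
  proof (cases "s = q")
    case True
    obtain n j where n: "1 \<le> n" "j < 2 ^ n" and
      small: "norm (\<Sum>i<2 ^ n. hadamard n j i *\<^sub>R A (B (unit_seq (block_start n + j))) (block_start n + i)) <
        real (2 ^ n) powr (1 - 1 / s) / 2"
      using factored_pairing_small[OF s r p(1) q1 B A] by blast
    define N where "N = real (2 ^ n)"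
    have N: "0 < N" by (simp add: N_def)
    define e :: "nat \<Rightarrow> 'a" where "e = unit_seq (block_start n + j)"
    have e: "e \<in> lp p" "lp_norm p e = 1" unfolding e_def by (rule lp_unit_seq; use p in simp)+
    define pair where "pair y = (\<Sum>i<2 ^ n. hadamard n j i *\<^sub>R y (block_start n + i))" for y :: "nat \<Rightarrow> 'a"
    have "pair (?V e) = (\<Sum>i<(2::nat) ^ n. of_real (N powr (- 1 / s)))"
      unfolding pair_def
    proof (intro sum.cong refl)
      fix i :: nat assume "i \<in> {..<2 ^ n}"
      then have "?V e (block_start n + i) = of_real (N powr (- 1 / s) * hadamard n i j)"
        unfolding e_def N_def using n by (intro scaled_hadamard_op_unit_seq) auto
      also have "hadamard n j i *\<^sub>R \<dots> = of_real (N powr (- 1 / s) * (hadamard n i j * hadamard n i j))"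
        by (simp add: scaleR_conv_of_real hadamard_commute[of n j i])
      finally show "hadamard n j i *\<^sub>R ?V e (block_start n + i) = of_real (N powr (- 1 / s))"
        by (simp add: hadamard_mult_self)
    qed
    also have "\<dots> = of_real (N powr (1 - 1 / s))"
      using N powr_add[of N 1 "- 1 / s"] by (simp add: N_def)
    finally have Ve: "norm (pair (?V e)) = N powr (1 - 1 / s)" by simp
    define z where "z = ?V e - S e"
    have z: "z \<in> lp q" "lp_norm q z \<le> 1 / 2" using in_q[OF e(1)] close[OF e(1)] e(2) by (auto simp: z_def)
    have "norm (pair z) \<le> (\<Sum>i<(2::nat) ^ n. norm (z (block_start n + i)))"
      unfolding pair_def by (rule order_trans[OF norm_sum]) (simp add: abs_hadamard)
    also have "\<dots> \<le> N powr (1 - 1 / s) / 2"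
    proof (rule powr_le_powr_imp_le)
      have "(\<Sum>i<(2::nat) ^ n. norm (z (block_start n + i))) powr q \<le>
          real (card {..<(2::nat) ^ n}) powr (q - 1) * (\<Sum>i<(2::nat) ^ n. norm (z (block_start n + i)) powr q)"
        using q1 by (intro power_mean_inequality) auto
      also have "\<dots> \<le> N powr (q - 1) * lp_norm q z powr q"
        unfolding N_def card_lessThan using q1 z(1) by (intro mult_left_mono lp_block_sum_le) auto
      also have "\<dots> \<le> N powr (q - 1) * (1 / 2) powr q"
        using z q1 by (intro mult_left_mono powr_mono2) (auto simp: lp_norm_nonneg)
      also have "\<dots> = (N powr (1 - 1 / s) / 2) powr q"
        using q1 N by (simp add: True powr_divide powr_powr left_diff_distrib)
      finally show "(\<Sum>i<(2::nat) ^ n. norm (z (block_start n + i))) powr q \<le> (N powr (1 - 1 / s) / 2) powr q" .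
    qed (use q1 in auto)
    finally have "norm (pair z) \<le> N powr (1 - 1 / s) / 2" .
    moreover have "norm (pair z) = norm (pair (?V e) - pair (S e))"
      by (simp add: pair_def z_def scaleR_diff_right sum_subtractf)
    moreover have "norm (pair (S e)) < N powr (1 - 1 / s) / 2"
      using small unfolding pair_def N_def SAB[OF e(1)] unfolding e_def .
    ultimately show False
      using Ve norm_triangle_ineq2[of "pair (?V e)" "pair (S e)"] by linarith
  next
    case False
    then have p_eq: "p = s / (s - 1)" using sharp by simp
    then have p_inv: "1 / p = 1 - 1 / s" using s by (simp add: p_eq field_simps)
    obtain n i where n: "1 \<le> n" "i < 2 ^ n" and
      small: "norm (A (B (hadamard_row n i)) (block_start n + i)) < real (2 ^ n) powr (1 - 1 / s) / 2"
      using factored_row_coordinate_small[OF s r p(1) q1 B A] by blast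
    define x :: "nat \<Rightarrow> 'a" where "x = hadamard_row n i"
    have x: "x \<in> lp p" "lp_norm p x = real (2 ^ n) powr (1 - 1 / s)"
      unfolding x_def p_inv[symmetric] by (rule lp_hadamard_row; use p in simp)+
    define l where "l = block_start n + i"
    have Vx: "norm (?V x l) = real (2 ^ n) powr (1 - 1 / s)"
      unfolding x_def l_def scaled_hadamard_op_row[OF n] by simp
    have "norm (?V x l - S x l) \<le> lp_norm q (?V x - S x)"
      using norm_le_lp_norm[OF _ in_q[OF x(1)], of l] q1 by simp
    also have "\<dots> \<le> real (2 ^ n) powr (1 - 1 / s) / 2" using close[OF x(1)] x(2) by simp
    finally have "norm (?V x l - S x l) \<le> real (2 ^ n) powr (1 - 1 / s) / 2" .
    moreover have "norm (S x l) < real (2 ^ n) powr (1 - 1 / s) / 2"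
      using small unfolding SAB[OF x(1)] unfolding x_def l_def .
    ultimately show False
      using Vx norm_triangle_ineq2[of "?V x l" "S x l"] by linarith
  qed
qed

section \<open>Properties of the block Hadamard operator\<close>

lemma bounded_op_inclusion:
  assumes "0 < a" "a \<le> b"
  shows "bounded_op a b (\<lambda>x :: nat \<Rightarrow> 'a::real_normed_field. x)"
  unfolding bounded_op_def using lp_mono[OF assms] by (auto intro!: exI[of _ 1])

text \<open>If \<open>p' \<le> q\<close>, then \<open>s = p'\<close> and \<open>s' = p\<close>; otherwise \<open>s = q\<close>, and \<open>q < p'\<close> means \<open>p < q'\<close>.\<close>

lemma hadamard_scaling_exponent:
  fixes p q :: real
  assumes "1 \<le> p" "p \<le> 2" "2 \<le> q"
  defines "s \<equiv> real_of_ereal (min (conj_exp p) (ereal q))"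
  shows "ereal s = min (conj_exp p) (ereal q)" "2 \<le> s" "p \<le> s / (s - 1)" "s \<le> q"
    "s = q \<or> p = s / (s - 1)"
proof -
  consider "p = 1" "s = q" | "1 < p" "s = min (p / (p - 1)) q"
  proof (cases "p = 1")
    case True
    then show ?thesis using that(1) by (simp add: s_def conj_exp_def)
  next
    case False
    then have "s = min (p / (p - 1)) q" by (simp add: s_def conj_exp_def min_def)
    then show ?thesis using that(2) False assms(1) by simp
  qed
  then have "ereal s = min (conj_exp p) (ereal q) \<and> 2 \<le> s \<and> p \<le> s / (s - 1) \<and> s \<le> q \<and>
      (s = q \<or> p = s / (s - 1))"
  proof cases
    case 1
    then show ?thesis using assms(1-3) by (simp add: conj_exp_def)
  next
    case 2
    show ?thesis
    proof (cases "p / (p - 1) \<le> q")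
      case True
      then have "s = p / (p - 1)" using 2 by simp
      moreover from this have "s - 1 = 1 / (p - 1)" using 2 by (simp add: field_simps)
      ultimately have "s / (s - 1) = p" using 2 by simp
      moreover have "2 \<le> p / (p - 1)" using 2(1) assms(2) by (simp add: field_simps)
      ultimately show ?thesis
        using 2 True \<open>s = p / (p - 1)\<close> by (simp add: conj_exp_def min_def)
    next
      case False
      then have "s = q" using 2 by simp
      then show ?thesis using 2 False assms(1-3) by (simp add: conj_exp_def min_def field_simps)
    qed
  qed
  then show "ereal s = min (conj_exp p) (ereal q)" "2 \<le> s" "p \<le> s / (s - 1)" "s \<le> q"
    "s = q \<or> p = s / (s - 1)" by auto
qed

theorem theorem5p4:
  fixes p q :: real
    and U :: "(nat \<Rightarrow> 'a::{real_normed_field, euclidean_space}) \<Rightarrow> nat \<Rightarrow> 'a"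
  assumes "1 \<le> p" and "p \<le> 2" and "2 \<le> q"
    and "U = hadamard_op p q"
  shows "(bounded_op p q U \<and> op_norm p q U = 1) \<and>
    \<not> compact_op p q U \<and>
    (conj_exp p \<noteq> ereal q \<longrightarrow> finitely_strictly_singular p q U) \<and>
    (\<forall>r. p \<le> r \<and> r \<le> q \<longrightarrow>
       (ereal r \<le> conj_exp q \<or> conj_exp p \<le> ereal r \<longrightarrow> factors_through r p q U) \<and>
       (\<not> (ereal r \<le> conj_exp q \<or> conj_exp p \<le> ereal r) \<and> r \<noteq> p \<and> r \<noteq> q \<longrightarrow>
          U \<notin> factor_closure r p q)) \<and>
    (p \<noteq> 2 \<and> q \<noteq> 2 \<longrightarrow> U \<notin> factor_closure 2 p q)"
proof -
  define s where "s = real_of_ereal (min (conj_exp p) (ereal q))"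
  note S = hadamard_scaling_exponent[OF assms(1-3), folded s_def]
  have U: "U = scaled_hadamard_op s" unfolding assms(4) s_def by (rule hadamard_op_eq_scaled)
  have conj_q: "conj_exp q = ereal (q / (q - 1))" using assms(3) by (simp add: conj_exp_def)
  have conj_mono: "q / (q - 1) \<le> s / (s - 1)" using S(2,4) by (simp add: field_simps)
  have UB: "bounded_op p q U" unfolding U by (rule bounded_op_scaled_hadamard[OF S(2) assms(1) S(3,4)])
  have fss: "finitely_strictly_singular p q U" if "conj_exp p \<noteq> ereal q"
  proof -
    have "p < s / (s - 1) \<or> s < q"
    proof (rule ccontr)
      assume "\<not> ?thesis"
      then have eq: "s = q" "p = s / (s - 1)" using S(3,4) by auto
      have "p - 1 = 1 / (s - 1)" using S(2) by (simp add: eq(2) field_simps)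
      then have "p / (p - 1) = (s / (s - 1)) / (1 / (s - 1))"
        by (rule arg_cong2[where f = "(/)", OF eq(2)])
      also have "\<dots> = s" using S(2) by simp
      finally have "p / (p - 1) = q" using eq(1) by simp
      moreover from this have "p \<noteq> 1" using assms(3) by auto
      ultimately show False using that by (simp add: conj_exp_def)
    qed
    then show ?thesis
      unfolding U by (rule finitely_strictly_singular_scaled_hadamard[OF S(2) assms(1) S(3,4)])
  qed
  have factors: "factors_through r p q U"
    if r: "p \<le> r" "r \<le> q" and cond: "ereal r \<le> conj_exp q \<or> conj_exp p \<le> ereal r" for r
    using cond
  proof
    assume "ereal r \<le> conj_exp q"
    then have "r \<le> s / (s - 1)" using conj_mono by (simp add: conj_q)
    then have "bounded_op r q U"
      unfolding U using assms(1) r S by (intro bounded_op_scaled_hadamard) auto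
    then show ?thesis
      unfolding factors_through_def using UB bounded_op_inclusion[of p r] assms(1) r by fastforce
  next
    assume "conj_exp p \<le> ereal r"
    then have "ereal s \<le> ereal r" unfolding S(1) by (simp add: min.coboundedI1)
    then have "s \<le> r" by simp
    then have "bounded_op p r U"
      unfolding U using assms(1) S(2,3) by (intro bounded_op_scaled_hadamard) auto
    then show ?thesis
      unfolding factors_through_def using UB bounded_op_inclusion[of r q] assms(1) r by fastforce
  qed
  have not_approx: "U \<notin> factor_closure r p q"
    if r: "p \<le> r" "r \<le> q" "\<not> (ereal r \<le> conj_exp q \<or> conj_exp p \<le> ereal r)" "r \<noteq> p" "r \<noteq> q" for r
    unfolding U
  proof (rule scaled_hadamard_not_in_factor_closure[OF S(2) assms(1) S(3-5)])
    show "s / (s - 1) < r" using S(5) r by (auto simp: conj_q)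
    have "ereal r < ereal s" unfolding S(1) using r by auto
    then show "r < s" by simp
  qed
  have not_approx_2: "U \<notin> factor_closure 2 p q" if "p \<noteq> 2" "q \<noteq> 2"
  proof (rule not_approx)
    show "\<not> (ereal 2 \<le> conj_exp q \<or> conj_exp p \<le> ereal 2)"
      using assms(1-3) that unfolding conj_q by (auto simp: conj_exp_def field_simps)
  qed (use assms(1-3) that in auto)
  show ?thesis
    using UB fss factors not_approx not_approx_2
      op_norm_scaled_hadamard[OF S(2) assms(1) S(3-5), where 'a = 'a]
      not_compact_op_scaled_hadamard[OF S(2) assms(1) S(3-5), where 'a = 'a]
    unfolding U by blast
qed

end
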